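(* Let $f_0(x)=\boldsymbol{\nu}_0e^{T_0x}\boldsymbol{t}_0$ be the density of a phase-type distribution with parameters $T_0,\boldsymbol{\nu}_0,\boldsymbol{t}_0=-T_0\boldsymbol{1}$, let $\theta>0$, $G_0(\theta)=\boldsymbol{\nu}_0(\theta\mathbb{I}-T_0)^{-1}\boldsymbol{t}_0$, $d=-\log G_0(\theta)>0$, and let $f_1(x)=\frac1{G_0(\theta)}e^{-\theta x}f_0(x)$, which is the density of the phase-type distribution with parameters $$T_1=\Delta^{-1}T_0\Delta-\theta\mathbb{I},\qquad \boldsymbol{\nu}_1=\boldsymbol{\nu}_0\Delta/G_0(\theta),\qquad \boldsymbol{t}_1=\Delta^{-1}\boldsymbol{t}_0,$$ where $\Delta$ is the diagonal matrix with $(\theta\mathbb{I}-T_0)^{-1}\boldsymbol{t}_0$ on the diagonal. Let $a<0<b$ and let $N$ be the number of observations in the Wald sequential probability ratio test of $f_0$ against $f_1$ with decision boundaries $a,b$. Then for each $i\in\{0,1\}$, the expected number of observations under hypothesis $H_i$ is $$\mathbb{E}_iN=-\int_0^{-a}\boldsymbol{\nu}_iW_i(y)\boldsymbol{t}_i\,dy+\boldsymbol{\nu}_iW_i(-a)W_i(-a+b+d)^{-1}\left(\int_0^{-a+b+d}W_i(y)\boldsymbol{t}_i\,dy+\boldsymbol{1}\right),$$ where $W_i(x)$, $x\ge0$, is the continuous matrix-valued function identified by $\int_0^\infty e^{-sx}W_i(x)\,dx=\left(T_i+\theta s\mathbb{I}+\boldsymbol{t}_i\boldsymbol{\nu}_ie^{-ds}\right)^{-1}$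 for all sufficiently large $s$.
   Context: Phase-type (PH) distributions: a PH distribution is the law of the life time (time to absorption) of a transient continuous-time Markov chain on finitely many states $1,\ldots,n$. It is parametrized by the $n\times n$ transition rate matrix $T$ of the chain restricted to the transient states (off-diagonal entries nonnegative, row sums nonpositive, all states transient), the row vector $\boldsymbol{\nu}$ giving the initial distribution on $\{1,\ldots,n\}$ (a probability vector), and the column vector of absorption rates $\boldsymbol{t}=-T\boldsymbol{1}$. Its density is $f(x)=\boldsymbol{\nu}e^{Tx}\boldsymbol{t}$. Here $\boldsymbol{1}$ is the column vector of ones and $\mathbb{I}$ is the $n\times n$ identity matrix. The diagonal entries of $\Delta$ lie in $(0,1)$. Wald's test: let $\zeta_1,\zeta_2,\ldots$ be i.i.d. with density $f$, where $f=f_0$ under hypothesis $H_0$ (probability measure $\mathbb{P}_0$, expectation $\mathbb{E}_0$) and $f=f_1$ under hypothesis $H_1$ (probability measure $\mathbb{P}_1$, expectation $\mathbb{E}_1$). Put $\Lambda_0=0$, $\Lambda_k=\sum_{j=1}^k\log\frac{f_0(\zeta_j)}{f_1(\zeta_j)}$. The number of observations is $N=\inf\{k\ge 0:\Lambda_k\notin(a,b)\}$. The functions $W_i$ are the (matrix-valued) scale functions of Markov additive processes without positive jumps; it is known from the general theory that continuous functions with the given transforms exist, are unique, and that $W_i(x)$ is non-singular for $x>0$. *)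

theory Defs
  imports "HOL-Probability.Probability"
begin

text \<open>
  The product \<open>*\<close> on \<^typ>\<open>real^'n^'n\<close> is componentwise, so the library function \<^const>\<open>exp\<close> is
  not the matrix exponential; it is defined here by its power series.
  A row vector acts by \<open>v*\<close>, and a row vector times a column vector is the inner product.
\<close>

definition matrix_power :: "real^'n^'n \<Rightarrow> nat \<Rightarrow> real^'n^'n" where
  "matrix_power A k = (((**) A) ^^ k) (mat 1)"

definition matrix_exp :: "real^'n^'n \<Rightarrow> real^'n^'n" where
  "matrix_exp A = (\<Sum>k. (1 / fact k) *\<^sub>R matrix_power A k)"

definition diag_matrix :: "real^'n \<Rightarrow> real^'n^'n" where
  "diag_matrix v = (\<chi> i j. if i = j then v $ i else 0)"

definition outer_product :: "real^'n \<Rightarrow> real^'n \<Rightarrow> real^'n^'n" where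
  "outer_product u v = (\<chi> i j. u $ i * v $ j)"


subsection \<open>Phase-type distributions\<close>

text \<open>Here \<open>1\<close> is the vector all of whose entries are one.\<close>

definition exit_rates :: "real^'n^'n \<Rightarrow> real^'n" where
  "exit_rates T = - (T *v 1)"

text \<open>
  The \<open>(j,j)\<close> entry of \<open>exp (x T)\<close> is the probability that the chain started in \<open>j\<close> is in \<open>j\<close>
  at time \<open>x\<close>. The state is transient iff the expected total time spent there is finite.
\<close>

definition transient_state :: "real^'n^'n \<Rightarrow> 'n \<Rightarrow> bool" where
  "transient_state T j \<longleftrightarrow>
     (\<integral>\<^sup>+x\<in>{0..}. ennreal (matrix_exp (x *\<^sub>R T) $ j $ j) \<partial>lborel) < \<infinity>"

definition phase_type_params :: "real^'n^'n \<Rightarrow> real^'n \<Rightarrow> bool" where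
  "phase_type_params T \<nu> \<longleftrightarrow>
     (\<forall>i j. i \<noteq> j \<longrightarrow> 0 \<le> T $ i $ j) \<and>
     (\<forall>i. (\<Sum>j\<in>UNIV. T $ i $ j) \<le> 0) \<and>
     (\<forall>j. transient_state T j) \<and>
     (\<forall>i. 0 \<le> \<nu> $ i) \<and> (\<Sum>i\<in>UNIV. \<nu> $ i) = 1"

definition phase_type_density :: "real^'n^'n \<Rightarrow> real^'n \<Rightarrow> real \<Rightarrow> real" where
  "phase_type_density T \<nu> x =
     (if x < 0 then 0 else \<nu> \<bullet> (matrix_exp (x *\<^sub>R T) *v exit_rates T))"


subsection \<open>Wald's test\<close>

text \<open>Observations are numbered from 1; \<open>\<zeta> 0\<close> is irrelevant.\<close>

definition iid_with_density :: "'w measure \<Rightarrow> (nat \<Rightarrow> 'w \<Rightarrow> real) \<Rightarrow> (real \<Rightarrow> real) \<Rightarrow> bool" where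
  "iid_with_density P \<zeta> f \<longleftrightarrow>
     prob_space P \<and>
     prob_space.indep_vars P (\<lambda>_. borel) \<zeta> {1..} \<and>
     (\<forall>j\<ge>1. distributed P lborel (\<zeta> j) (\<lambda>x. ennreal (f x)))"

definition log_likelihood_ratio ::
    "(real \<Rightarrow> real) \<Rightarrow> (real \<Rightarrow> real) \<Rightarrow> (nat \<Rightarrow> 'w \<Rightarrow> real) \<Rightarrow> nat \<Rightarrow> 'w \<Rightarrow> real" where
  "log_likelihood_ratio f\<^sub>0 f\<^sub>1 \<zeta> k \<omega> = (\<Sum>j=1..k. ln (f\<^sub>0 (\<zeta> j \<omega>) / f\<^sub>1 (\<zeta> j \<omega>)))"

text \<open>The infimum of the empty set is \<open>\<infinity>\<close>.\<close>

definition num_observations ::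
    "(real \<Rightarrow> real) \<Rightarrow> (real \<Rightarrow> real) \<Rightarrow> real \<Rightarrow> real \<Rightarrow> (nat \<Rightarrow> 'w \<Rightarrow> real) \<Rightarrow> 'w \<Rightarrow> enat" where
  "num_observations f\<^sub>0 f\<^sub>1 a b \<zeta> \<omega> =
     Inf (enat ` {k. log_likelihood_ratio f\<^sub>0 f\<^sub>1 \<zeta> k \<omega> \<notin> {a<..<b}})"


subsection \<open>Scale functions\<close>

text \<open>Only the values of \<open>W\<close> on \<open>{0..}\<close> matter.\<close>

definition scale_function ::
    "real^'n^'n \<Rightarrow> real^'n \<Rightarrow> real^'n \<Rightarrow> real \<Rightarrow> real \<Rightarrow> (real \<Rightarrow> real^'n^'n) \<Rightarrow> bool" where
  "scale_function T \<nu> t \<theta> d W \<longleftrightarrow>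
     continuous_on {0..} W \<and>
     (\<exists>s\<^sub>0. \<forall>s>s\<^sub>0.
        set_integrable lborel {0..} (\<lambda>x. exp (- s * x) *\<^sub>R W x) \<and>
        invertible (T + mat (\<theta> * s) + exp (- d * s) *\<^sub>R outer_product t \<nu>) \<and>
        (LINT x:{0..}|lborel. exp (- s * x) *\<^sub>R W x) =
          matrix_inv (T + mat (\<theta> * s) + exp (- d * s) *\<^sub>R outer_product t \<nu>))"

end

theory Submission
  imports Defs
begin

text \<open>
  The ratio \<open>f\<^sub>0 / f\<^sub>1\<close> is \<open>G\<^sub>0 exp (\<theta> x)\<close>, so under either hypothesis the log-likelihood ratio is a random walk with
  steps \<open>\<theta> \<zeta>\<^sub>j - d\<close>, and \<open>N\<close> is its first exit time from \<open>(a, b)\<close>. Shifted by \<open>- a\<close>, the walk starts at \<open>- a\<close>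
  and lives on \<open>(0, b - a)\<close>; let \<open>c = b - a + d\<close>. It can be interpolated by a level that climbs at rate \<open>\<theta>\<close> while
  the phase process of an observation runs and drops by \<open>d\<close> when that process is absorbed. Let \<open>g y\<close> be the vector
  of expected numbers of observations still to be completed when the level is \<open>y\<close>, indexed by the phase. Since one more
  observation ends at each absorption,
  \<open>\<theta> g' + T g + t (1 + \<nu> g(\<cdot> - d)) = 0\<close>, with \<open>g = 0\<close> below zero, and \<open>g c = 1\<close> because from level \<open>c\<close> on only
  the current observation remains.

  Uniqueness of Laplace transforms (\<open>laplace_unique\<close>) turns the definition of \<open>W\<close> into the equation
  \<open>\<theta> W' + T W + t \<nu> W(\<cdot> - d) = 0\<close> (\<open>scale_function_integral_equation\<close>). Therefore
  \<open>g y = W y K - (\<integral>\<^sub>0\<^sup>y W) t\<close> solves the equation for \<open>g\<close>, and the boundary condition fixes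
  \<open>K = W(c)\<^sup>-\<^sup>1 ((\<integral>\<^sub>0\<^sup>c W) t + 1)\<close>. Variation of constants with \<open>exp (x T)\<close> rewrites this as a scalar renewal equation
  for \<open>m = \<nu> g\<close> (\<open>scale_renewal\<close>): \<open>m y\<close> is \<open>1\<close> plus the expectation of \<open>m\<close> after one step of the walk,
  restricted to the interval. Along the walk a bounded solution telescopes to \<open>\<Sum>\<^sub>k P(N > k) = m(- a)\<close>
  (\<open>random_walk_exit_time\<close>), and \<open>m(- a)\<close> is the claimed formula.

  The same renewal equation without the term \<open>1\<close> shows that \<open>W c\<close> is non-singular: a kernel vector would give a
  solution whose supremum shrinks by a factor below \<open>1\<close> in each step (\<open>scale_function_invertible\<close>).

  That \<open>f\<^sub>1\<close> is again a phase-type density is a Doob transform (\<open>exponential_tilting\<close>). The vector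
  \<open>u = (\<theta> - T\<^sub>0)\<^sup>-\<^sup>1 t\<^sub>0\<close> of Laplace transforms of the life time has to have entries strictly between \<open>0\<close> and \<open>1\<close>.
  Positivity is where transience enters, through a maximum principle for \<open>T\<^sub>0\<close> (\<open>transient_max_principle\<close>) that is
  obtained by bounding its resolvent uniformly near zero.
\<close>

section \<open>The matrix exponential\<close>

lemma has_vector_derivative_vecI:
  fixes f :: "real \<Rightarrow> 'a::euclidean_space ^ 'n"
  assumes "\<And>i. ((\<lambda>x. f x $ i) has_vector_derivative f' $ i) (at x within S)"
  shows "(f has_vector_derivative f') (at x within S)"
proof -
  have "((\<lambda>x. f x \<bullet> b) has_derivative (\<lambda>h. (h *\<^sub>R f') \<bullet> b)) (at x within S)" if "b \<in> Basis" for b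
  proof -
    from that obtain i u where b: "b = axis i u" and "u \<in> Basis"
      by (auto simp: Basis_vec_def)
    have "((\<lambda>x. f x $ i \<bullet> u) has_derivative (\<lambda>h. (h *\<^sub>R f' $ i) \<bullet> u)) (at x within S)"
      using assms[of i] unfolding has_vector_derivative_def by (rule has_derivative_inner_left)
    then show ?thesis by (simp add: b inner_axis)
  qed
  then show ?thesis
    unfolding has_vector_derivative_def by (subst has_derivative_componentwise_within) auto
qed

lemma bounded_bilinear_matrix_vector_mult:
  "bounded_bilinear ((*v) :: real^'n^'m \<Rightarrow> real^'n \<Rightarrow> real^'m)"
  unfolding bilinear_conv_bounded_bilinear[symmetric] bilinear_def
  by (auto intro!: linearI simp: algebra_simps scaleR_matrix_vector_assoc)

lemma bounded_bilinear_matrix_matrix_mult: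
  "bounded_bilinear ((**) :: real^'n^'m \<Rightarrow> real^'k^'n \<Rightarrow> real^'k^'m)"
  unfolding bilinear_conv_bounded_bilinear[symmetric] bilinear_def
  by (auto intro!: linearI simp: matrix_add_ldistrib matrix_scalar_ac scalar_matrix_assoc
    vec_eq_iff matrix_matrix_mult_def sum.distrib algebra_simps sum_distrib_left)

lemma mat_matrix_mult: "mat c ** A = c *\<^sub>R (A :: real^'m^'n)"
  by (simp add: vec_eq_iff matrix_matrix_mult_def mat_def if_distrib if_distribR cong: if_cong)

lemma matrix_power_0 [simp]: "matrix_power A 0 = mat 1"
  by (simp add: matrix_power_def)

lemma matrix_power_Suc: "matrix_power A (Suc k) = A ** matrix_power A k"
  by (simp add: matrix_power_def)

lemma matrix_power_Suc2: "matrix_power A (Suc k) = matrix_power A k ** A"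
  by (induction k) (simp_all add: matrix_power_Suc matrix_mul_assoc)

lemma matrix_power_scaleR: "matrix_power (x *\<^sub>R A) k = x ^ k *\<^sub>R matrix_power A k"
  by (induction k) (simp_all add: matrix_power_Suc matrix_scalar_ac scalar_matrix_assoc mult.commute)

lemma matrix_power_entry_bound:
  "\<bar>matrix_power A k $ i $ j\<bar> \<le> (\<Sum>i\<in>UNIV. \<Sum>j\<in>UNIV. \<bar>A $ i $ j\<bar>) ^ k"
proof (induction k arbitrary: i j)
  case 0
  then show ?case by (simp add: mat_def)
next
  case (Suc k)
  let ?C = "\<Sum>i\<in>UNIV. \<Sum>j\<in>UNIV. \<bar>A $ i $ j\<bar>"
  have "\<bar>matrix_power A (Suc k) $ i $ j\<bar> \<le> (\<Sum>l\<in>UNIV. \<bar>A $ i $ l\<bar> * \<bar>matrix_power A k $ l $ j\<bar>)"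
    by (simp add: matrix_power_Suc matrix_matrix_mult_def abs_mult[symmetric] sum_abs)
  also have "\<dots> \<le> (\<Sum>l\<in>UNIV. \<bar>A $ i $ l\<bar> * ?C ^ k)"
    by (intro sum_mono mult_left_mono Suc) auto
  also have "\<dots> = (\<Sum>l\<in>UNIV. \<bar>A $ i $ l\<bar>) * ?C ^ k"
    by (simp add: sum_distrib_right)
  also have "\<dots> \<le> ?C * ?C ^ k"
    by (intro mult_right_mono zero_le_power sum_nonneg member_le_sum[of i UNIV "\<lambda>i. \<Sum>j\<in>UNIV. \<bar>A $ i $ j\<bar>"]) auto
  finally show ?case by simp
qed

text \<open>
  Working entrywise makes \<open>x \<mapsto> exp (x A)\<close> a real power series with infinite radius of convergence, so that it can
  be differentiated termwise.
\<close>

lemma summable_matrix_exp_entry: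
  "summable (\<lambda>k. matrix_power A k $ i $ j / fact k * x ^ k)"
proof (rule summable_comparison_test')
  let ?C = "\<Sum>i\<in>UNIV. \<Sum>j\<in>UNIV. \<bar>A $ i $ j\<bar>"
  show "summable (\<lambda>k. inverse (fact k) * (?C * \<bar>x\<bar>) ^ k)"
    by (rule summable_exp)
  show "norm (matrix_power A k $ i $ j / fact k * x ^ k) \<le> inverse (fact k) * (?C * \<bar>x\<bar>) ^ k" for k
    using mult_right_mono[OF matrix_power_entry_bound[of A k i j], of "\<bar>x\<bar>^k / fact k"]
    by (simp add: abs_mult power_mult_distrib power_abs field_simps)
qed

lemma matrix_exp_sums:
  "(\<lambda>k. matrix_power A k $ i $ j / fact k * x ^ k) sums (matrix_exp (x *\<^sub>R A) $ i $ j)"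
proof -
  define L where "L = (\<chi> i j. \<Sum>k. matrix_power A k $ i $ j / fact k * x ^ k)"
  have "(\<lambda>k. (1 / fact k) *\<^sub>R matrix_power (x *\<^sub>R A) k) sums L"
    unfolding sums_def
  proof (intro vec_tendstoI)
    fix i j
    show "((\<lambda>n. (\<Sum>k<n. (1 / fact k) *\<^sub>R matrix_power (x *\<^sub>R A) k) $ i $ j) \<longlonglongrightarrow> L $ i $ j)"
      using summable_LIMSEQ[OF summable_matrix_exp_entry[of A i j x]]
      by (simp add: L_def sum_component matrix_power_scaleR mult.commute)
  qed
  then have "matrix_exp (x *\<^sub>R A) = L"
    unfolding matrix_exp_def by (rule sums_unique[symmetric])
  then show ?thesis
    using summable_sums[OF summable_matrix_exp_entry[of A i j x]] by (simp add: L_def)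
qed

lemma matrix_exp_0 [simp]: "matrix_exp (0 :: real^'n^'n) = mat 1"
proof -
  have "(\<lambda>k. matrix_power 0 k $ i $ j / fact k * 0 ^ k) sums (mat 1 $ i $ j)" for i j :: 'n
    using sums_If_finite_set[of "{0}" "\<lambda>k. matrix_power 0 k $ i $ j"]
    by (simp add: power_0_left if_distrib cong: if_cong)
  from sums_unique2[OF matrix_exp_sums this] show ?thesis
    by (simp add: vec_eq_iff)
qed

lemma matrix_exp_entry_deriv:
  fixes A :: "real^'n^'n"
  defines "E \<equiv> \<lambda>x. matrix_exp (x *\<^sub>R A)"
  shows "((\<lambda>x. E x $ i $ j) has_field_derivative (A ** E x) $ i $ j) (at x)"
    and "((\<lambda>x. E x $ i $ j) has_field_derivative (E x ** A) $ i $ j) (at x)"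
proof -
  let ?c = "\<lambda>k. matrix_power A k $ i $ j / fact k"
  have diffs: "diffs ?c k = matrix_power A (Suc k) $ i $ j / fact k" for k
    by (simp add: diffs_def del: of_nat_Suc)
  have E: "E x $ i $ j = (\<Sum>k. matrix_power A k $ i $ j / fact k * x ^ k)" for x i j
    unfolding E_def using matrix_exp_sums by (rule sums_unique)
  have D: "((\<lambda>x. E x $ i $ j) has_field_derivative (\<Sum>k. matrix_power A (Suc k) $ i $ j / fact k * x ^ k)) (at x)"
    unfolding E diffs[symmetric]
    by (rule termdiffs_strong_converges_everywhere) (rule summable_matrix_exp_entry)
  have "(\<lambda>k. \<Sum>l\<in>UNIV. A $ i $ l * (matrix_power A k $ l $ j / fact k * x ^ k))
      sums (\<Sum>l\<in>UNIV. A $ i $ l * E x $ l $ j)"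
    unfolding E_def by (intro sums_sum sums_mult matrix_exp_sums)
  then have "(\<lambda>k. matrix_power A (Suc k) $ i $ j / fact k * x ^ k) sums ((A ** E x) $ i $ j)"
    by (simp add: matrix_power_Suc matrix_matrix_mult_def sum_distrib_right sum_divide_distrib mult.assoc)
  from sums_unique[OF this] show "((\<lambda>x. E x $ i $ j) has_field_derivative (A ** E x) $ i $ j) (at x)"
    using D by simp
  have "(\<lambda>k. \<Sum>l\<in>UNIV. (matrix_power A k $ i $ l / fact k * x ^ k) * A $ l $ j)
      sums (\<Sum>l\<in>UNIV. E x $ i $ l * A $ l $ j)"
    unfolding E_def by (intro sums_sum sums_mult2 matrix_exp_sums)
  then have "(\<lambda>k. matrix_power A (Suc k) $ i $ j / fact k * x ^ k) sums ((E x ** A) $ i $ j)"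
    by (simp add: matrix_power_Suc2 matrix_matrix_mult_def sum_distrib_left sum_divide_distrib mult_ac)
  from sums_unique[OF this] show "((\<lambda>x. E x $ i $ j) has_field_derivative (E x ** A) $ i $ j) (at x)"
    using D by simp
qed

lemma
  fixes A :: "real^'n^'n"
  shows matrix_exp_deriv: "((\<lambda>x. matrix_exp (x *\<^sub>R A)) has_vector_derivative A ** matrix_exp (x *\<^sub>R A)) (at x within S)"
    and matrix_exp_deriv': "((\<lambda>x. matrix_exp (x *\<^sub>R A)) has_vector_derivative matrix_exp (x *\<^sub>R A) ** A) (at x within S)"
  using matrix_exp_entry_deriv[of A, THEN DERIV_subset]
  by (auto intro!: has_vector_derivative_vecI simp: has_real_derivative_iff_has_vector_derivative[symmetric])

lemma continuous_on_matrix_exp [continuous_intros]: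
  assumes "continuous_on S h"
  shows "continuous_on S (\<lambda>x. matrix_exp (h x *\<^sub>R A))"
proof -
  have "continuous_on UNIV (\<lambda>x. matrix_exp (x *\<^sub>R A))"
    by (auto intro!: differentiable_imp_continuous_on differentiableI_vector matrix_exp_deriv simp: differentiable_on_def)
  then show ?thesis
    using continuous_on_compose2[OF _ assms] by blast
qed

text \<open>
  \<open>exp (- x A) F(x)\<close> has derivative zero, hence is constantly \<open>1\<close>; applied to \<open>F(x) = exp (x A)\<close> the same
  argument inverts \<open>exp (- x A)\<close>. Identities such as \<open>exp (x (A + q)) = e\<^sup>q\<^sup>x exp (x A)\<close> are obtained from this
  characterisation.
\<close>

lemma matrix_exp_uniq:
  fixes A :: "real^'n^'n"
  assumes deriv: "\<And>x. (F has_vector_derivative A ** F x) (at x)" and F0: "F 0 = mat 1"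
  shows "F x = matrix_exp (x *\<^sub>R A)"
proof -
  have const: "matrix_exp ((-x) *\<^sub>R A) ** F x = mat 1"
    if deriv: "\<And>x. (F has_vector_derivative A ** F x) (at x)" and F0: "F 0 = mat 1" for F x
  proof -
    have "((\<lambda>x. matrix_exp ((-x) *\<^sub>R A) ** F x) has_vector_derivative
        matrix_exp ((-x) *\<^sub>R A) ** (A ** F x) + (- (matrix_exp ((-x) *\<^sub>R A) ** A)) ** F x) (at x)" for x
    proof (rule bounded_bilinear.has_vector_derivative[OF bounded_bilinear_matrix_matrix_mult _ deriv])
      show "((\<lambda>x. matrix_exp ((-x) *\<^sub>R A)) has_vector_derivative - (matrix_exp ((-x) *\<^sub>R A) ** A)) (at x)"
      proof -
        have "(uminus has_vector_derivative - 1) (at x)"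
          by (auto intro!: derivative_eq_intros simp: has_real_derivative_iff_has_vector_derivative[symmetric])
        from vector_diff_chain_at[OF this matrix_exp_deriv'] show ?thesis
          by (simp add: o_def)
      qed
    qed
    then have "((\<lambda>x. matrix_exp ((-x) *\<^sub>R A) ** F x) has_vector_derivative 0) (at x)" for x
      by (simp add: matrix_mul_assoc bounded_bilinear.minus_left[OF bounded_bilinear_matrix_matrix_mult])
    then obtain c where c: "\<And>x. matrix_exp ((-x) *\<^sub>R A) ** F x = c"
      using has_vector_derivative_zero_constant[OF convex_UNIV, of "\<lambda>x. matrix_exp ((-x) *\<^sub>R A) ** F x"] by auto
    from c[of 0] c[of x] show ?thesis
      by (simp add: F0)
  qed
  have "matrix_exp ((-x) *\<^sub>R A) ** matrix_exp (x *\<^sub>R A) = mat 1"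
    by (rule const) (auto intro: matrix_exp_deriv)
  then have inv: "matrix_exp (x *\<^sub>R A) ** matrix_exp ((-x) *\<^sub>R A) = mat 1"
    by (simp only: matrix_left_right_inverse)
  have "F x = (matrix_exp (x *\<^sub>R A) ** matrix_exp ((-x) *\<^sub>R A)) ** F x"
    by (simp only: inv matrix_mul_lid)
  also have "\<dots> = matrix_exp (x *\<^sub>R A) ** (matrix_exp ((-x) *\<^sub>R A) ** F x)"
    by (simp only: matrix_mul_assoc)
  also have "\<dots> = matrix_exp (x *\<^sub>R A)"
    by (simp only: const[OF deriv F0] matrix_mul_rid)
  finally show ?thesis .
qed

section \<open>Substochastic semigroups\<close>

definition subintensity :: "real^'n^'n \<Rightarrow> bool" where
  "subintensity T \<longleftrightarrow> (\<forall>i j. i \<noteq> j \<longrightarrow> 0 \<le> T $ i $ j) \<and> (\<forall>i. 0 \<le> exit_rates T $ i)"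

lemma exit_rates_nth: "exit_rates T $ i = - (\<Sum>j\<in>UNIV. T $ i $ j)"
  by (simp add: exit_rates_def matrix_vector_mult_def)

lemma matrix_exp_mono_diag:
  fixes A :: "real^'n^'n"
  assumes "\<And>i j. 0 \<le> A $ i $ j" and x: "0 \<le> x"
  shows "mat 1 $ i $ j \<le> matrix_exp (x *\<^sub>R A) $ i $ j"
proof -
  have nonneg: "0 \<le> matrix_power A k $ i $ j" for k i j
    by (induction k arbitrary: i j) (auto simp: matrix_power_Suc mat_def matrix_matrix_mult_def assms intro!: sum_nonneg)
  have "(\<Sum>k<Suc 0. matrix_power A k $ i $ j / fact k * x ^ k) \<le> (\<Sum>k. matrix_power A k $ i $ j / fact k * x ^ k)"
    by (intro sum_le_suminf summable_matrix_exp_entry) (auto simp: nonneg x)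
  then show ?thesis
    by (simp add: sums_unique[OF matrix_exp_sums])
qed

lemma matrix_exp_shift:
  fixes A :: "real^'n^'n"
  shows "matrix_exp (x *\<^sub>R (A + mat q)) = exp (q * x) *\<^sub>R matrix_exp (x *\<^sub>R A)"
proof (rule matrix_exp_uniq[symmetric])
  fix x
  have "((\<lambda>x. exp (q * x) *\<^sub>R matrix_exp (x *\<^sub>R A)) has_vector_derivative
      exp (q * x) *\<^sub>R (A ** matrix_exp (x *\<^sub>R A)) + (exp (q * x) * q) *\<^sub>R matrix_exp (x *\<^sub>R A)) (at x)"
    by (rule has_vector_derivative_scaleR[OF _ matrix_exp_deriv]) (auto intro!: derivative_eq_intros)
  then show "((\<lambda>x. exp (q * x) *\<^sub>R matrix_exp (x *\<^sub>R A)) has_vector_derivative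
      (A + mat q) ** (exp (q * x) *\<^sub>R matrix_exp (x *\<^sub>R A))) (at x)"
    by (simp add: bounded_bilinear.scaleR_right[OF bounded_bilinear_matrix_matrix_mult] bounded_bilinear.add_left[OF bounded_bilinear_matrix_matrix_mult] mat_matrix_mult scaleR_add_right mult.commute)
qed simp

text \<open>
  Uniformisation: for large \<open>q\<close> the matrix \<open>T + q\<close> is nonnegative, and the shift by \<open>q\<close> only multiplies the
  exponential by a positive scalar. The diagonal part of the bound keeps the survival probability away from zero
  on bounded time intervals.
\<close>

lemma matrix_exp_offdiag_nonneg:
  fixes T :: "real^'n^'n"
  assumes "\<And>i j. i \<noteq> j \<Longrightarrow> 0 \<le> T $ i $ j"
  obtains q where "\<And>x i j. 0 \<le> x \<Longrightarrow> exp (- q * x) * (mat 1 $ i $ j) \<le> matrix_exp (x *\<^sub>R T) $ i $ j"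
proof
  let ?q = "\<Sum>i\<in>UNIV. \<bar>T $ i $ i\<bar>"
  fix x :: real and i j assume x: "0 \<le> x"
  have "\<bar>T $ i $ i\<bar> \<le> ?q" for i
    by (rule member_le_sum) auto
  then have "0 \<le> T $ i $ i + ?q" for i
    using abs_le_D2[of "T $ i $ i" ?q] by simp
  then have "0 \<le> (T + mat ?q) $ i $ j" for i j
    using assms[of i j] by (cases "i = j") (auto simp: mat_def)
  from matrix_exp_mono_diag[OF this x, of i j]
  have "exp (- ?q * x) * (mat 1 $ i $ j) \<le> exp (- ?q * x) * (exp (?q * x) * matrix_exp (x *\<^sub>R T) $ i $ j)"
    by (intro mult_left_mono) (simp_all add: matrix_exp_shift)
  then show "exp (- ?q * x) * (mat 1 $ i $ j) \<le> matrix_exp (x *\<^sub>R T) $ i $ j"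
    by (simp add: mult.assoc[symmetric] exp_minus)
qed

lemma matrix_exp_nonneg:
  assumes "subintensity T" "0 \<le> x"
  shows "0 \<le> matrix_exp (x *\<^sub>R T) $ i $ j"
proof -
  obtain q where "\<And>x i j. 0 \<le> x \<Longrightarrow> exp (- q * x) * (mat 1 $ i $ j) \<le> matrix_exp (x *\<^sub>R T) $ i $ j"
    using matrix_exp_offdiag_nonneg assms(1) unfolding subintensity_def by blast
  from this[of x i j] assms(2) show ?thesis
    by (simp add: mat_def split: if_splits) (meson exp_ge_zero order_trans)
qed

lemma matrix_exp_vector_mono:
  assumes "subintensity T" "0 \<le> x" "\<And>i. u $ i \<le> v $ i"
  shows "(matrix_exp (x *\<^sub>R T) *v u) $ i \<le> (matrix_exp (x *\<^sub>R T) *v v) $ i"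
  unfolding matrix_vector_mult_def
  using assms by (auto intro!: sum_mono mult_left_mono matrix_exp_nonneg)

lemma matrix_exp_vector_deriv:
  "((\<lambda>x. matrix_exp (x *\<^sub>R A) *v v) has_vector_derivative matrix_exp (x *\<^sub>R A) *v (A *v v)) (at x within S)"
  using bounded_bilinear.has_vector_derivative[OF bounded_bilinear_matrix_vector_mult matrix_exp_deriv'[of A x S] has_vector_derivative_const[of v]]
  by (simp add: matrix_vector_mul_assoc)

text \<open>
  The vector \<open>exp (x T) 1\<close> holds the probabilities of being alive at time \<open>x\<close>, and \<open>exp (u T) t\<close> the densities
  of the life time; the two sides are both the probability of absorption before \<open>x\<close>.
\<close>

lemma survival_integral:
  assumes "0 \<le> x"
  shows "((\<lambda>u. matrix_exp (u *\<^sub>R T) *v exit_rates T) has_integral (1 - matrix_exp (x *\<^sub>R T) *v 1)) {0..x}"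
proof -
  have "((\<lambda>u. matrix_exp (u *\<^sub>R T) *v (T *v 1)) has_integral (matrix_exp (x *\<^sub>R T) *v 1 - matrix_exp (0 *\<^sub>R T) *v 1)) {0..x}"
    using assms by (intro fundamental_theorem_of_calculus matrix_exp_vector_deriv)
  from has_integral_neg[OF this] show ?thesis
    by (simp add: exit_rates_def linear_neg[OF matrix_vector_mul_linear])
qed

lemma survival_le_1:
  assumes "subintensity T" "0 \<le> x"
  shows "(matrix_exp (x *\<^sub>R T) *v 1) $ i \<le> 1"
proof -
  have "((\<lambda>u. (matrix_exp (u *\<^sub>R T) *v exit_rates T) $ i) has_integral (1 - matrix_exp (x *\<^sub>R T) *v 1) $ i) {0..x}"
    using has_integral_linear[OF survival_integral[OF assms(2), of T] bounded_linear_vec_nth[of i]] by (simp add: o_def)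
  moreover have "0 \<le> (matrix_exp (u *\<^sub>R T) *v exit_rates T) $ i" if "u \<in> {0..x}" for u
    using matrix_exp_vector_mono[OF assms(1), of u 0 "exit_rates T" i] that assms(1)
    by (simp add: subintensity_def)
  ultimately have "0 \<le> (1 - matrix_exp (x *\<^sub>R T) *v 1) $ i"
    by (rule has_integral_nonneg)
  then show ?thesis by simp
qed

lemma survival_lower_bound:
  assumes "subintensity (T :: real^'n^'n)"
  obtains q where "\<And>x i. 0 \<le> x \<Longrightarrow> exp (- q * x) \<le> (matrix_exp (x *\<^sub>R T) *v 1) $ i"
proof -
  obtain q where q: "\<And>x i j. 0 \<le> x \<Longrightarrow> exp (- q * x) * (mat 1 $ i $ j) \<le> matrix_exp (x *\<^sub>R T) $ i $ j"
    using matrix_exp_offdiag_nonneg assms unfolding subintensity_def by blast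
  have "exp (- q * x) \<le> (matrix_exp (x *\<^sub>R T) *v 1) $ i" if x: "0 \<le> x" for x i
  proof -
    have "exp (- q * x) \<le> matrix_exp (x *\<^sub>R T) $ i $ i"
      using q[OF x, of i i] by (simp add: mat_def)
    also have "\<dots> \<le> (\<Sum>j\<in>UNIV. matrix_exp (x *\<^sub>R T) $ i $ j)"
      using matrix_exp_nonneg[OF assms x] by (intro member_le_sum) auto
    finally show ?thesis by (simp add: matrix_vector_mult_def)
  qed
  then show thesis by (rule that)
qed

section \<open>Resolvents and transience\<close>

lemma mat_vector_mult: "mat c *v h = c *\<^sub>R (h :: real^'n)"
  by (simp add: vec_eq_iff matrix_vector_mult_def mat_def if_distribR if_distrib cong: if_cong)

text \<open>
  At a state \<open>m\<close> where \<open>h\<close> is smallest, \<open>T h\<close> is at least \<open>h m\<close> times a row sum of \<open>T\<close>; if \<open>h m\<close> were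
  negative this product would be nonnegative and \<open>\<kappa> h - T h\<close> would be negative at \<open>m\<close>.
\<close>

lemma resolvent_max_principle:
  fixes T :: "real^'n^'n"
  assumes T: "subintensity T" and lam: "0 < \<kappa>"
    and h: "\<And>i. 0 \<le> ((mat \<kappa> - T) *v h) $ i"
  shows "0 \<le> h $ i"
proof -
  obtain m where m: "\<And>j. h $ m \<le> h $ j"
    using ex_is_arg_min_if_finite[of UNIV "\<lambda>j. h $ j"] by (auto simp: is_arg_min_linorder)
  have "0 \<le> h $ m"
  proof (rule ccontr)
    assume neg: "\<not> 0 \<le> h $ m"
    have "(\<Sum>j\<in>UNIV. T $ m $ j * h $ m) \<le> (\<Sum>j\<in>UNIV. T $ m $ j * h $ j)"
    proof (rule sum_mono)
      fix j show "T $ m $ j * h $ m \<le> T $ m $ j * h $ j"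
        using T m[of j] by (cases "m = j") (auto simp: subintensity_def intro: mult_left_mono)
    qed
    also have "(\<Sum>j\<in>UNIV. T $ m $ j * h $ m) = - exit_rates T $ m * h $ m"
      by (simp add: exit_rates_nth sum_distrib_right)
    finally have "- exit_rates T $ m * h $ m \<le> (T *v h) $ m"
      by (simp add: matrix_vector_mult_def)
    moreover have "0 \<le> - exit_rates T $ m * h $ m"
      using neg T by (simp add: subintensity_def mult_nonneg_nonpos)
    moreover have "((mat \<kappa> - T) *v h) $ m = \<kappa> * h $ m - (T *v h) $ m"
      by (simp add: matrix_vector_mult_diff_rdistrib mat_vector_mult)
    ultimately have "0 \<le> \<kappa> * h $ m" using h[of m] by linarith
    then show False using neg lam by (simp add: zero_le_mult_iff)
  qed
  with m show ?thesis by (rule order_trans[rotated])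
qed

lemma invertible_resolvent:
  fixes T :: "real^'n^'n"
  assumes T: "subintensity T" and lam: "0 < \<kappa>"
  shows "invertible (mat \<kappa> - T)"
proof -
  have "h = 0" if "(mat \<kappa> - T) *v h = 0" for h
  proof -
    have "(mat \<kappa> - T) *v (- h) = 0"
      using that by (simp add: linear_neg[OF matrix_vector_mul_linear])
    with that resolvent_max_principle[OF T lam, of h] resolvent_max_principle[OF T lam, of "- h"]
    have "\<And>i. 0 \<le> h $ i" "\<And>i. 0 \<le> (- h) $ i" by simp_all
    then show ?thesis by (force simp: vec_eq_iff intro: antisym)
  qed
  then show ?thesis
    using matrix_left_invertible_ker[of "mat \<kappa> - T"] by (simp add: invertible_left_inverse)
qed

lemma matrix_inv_inverse:
  assumes "invertible (A :: real^'n^'n)"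
  shows "A ** matrix_inv A = mat 1" "matrix_inv A ** A = mat 1"
  using someI_ex[OF assms[unfolded invertible_def]] by (simp_all add: matrix_inv_def)

lemma matrix_inv_mult:
  assumes "invertible (A :: real^'n^'n)"
  shows "A *v (matrix_inv A *v v) = v" "matrix_inv A *v (A *v v) = v"
  using matrix_inv_inverse[OF assms] by (simp_all add: matrix_vector_mul_assoc)

text \<open>
  Column \<open>j\<close> of the resolvent is the discounted expected time spent in \<open>j\<close>. A chain started elsewhere accumulates
  such time only after reaching \<open>j\<close>. Analytically, the column is \<open>\<kappa>\<close>-harmonic off \<open>j\<close> and so takes its maximum
  at \<open>j\<close>.
\<close>

lemma resolvent_entry_le_diag:
  fixes T :: "real^'n^'n"
  assumes T: "subintensity T" and kap: "0 < \<kappa>"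
  shows "0 \<le> matrix_inv (mat \<kappa> - T) $ i $ j"
    and "matrix_inv (mat \<kappa> - T) $ i $ j \<le> matrix_inv (mat \<kappa> - T) $ j $ j"
proof -
  define r where "r = matrix_inv (mat \<kappa> - T) *v axis j 1"
  have r: "matrix_inv (mat \<kappa> - T) $ i $ j = r $ i" for i
    by (simp add: r_def matrix_vector_mul_component inner_axis)
  have eq: "(mat \<kappa> - T) *v r = axis j 1"
    unfolding r_def by (rule matrix_inv_mult[OF invertible_resolvent[OF T kap]])
  have nonneg: "0 \<le> r $ i" for i
    by (rule resolvent_max_principle[OF T kap]) (simp add: eq axis_def)
  have "0 \<le> (r $ j *\<^sub>R 1 - r) $ i"
  proof (cases "\<exists>m. m \<noteq> j \<and> (\<forall>k. r $ k \<le> r $ m)")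
    case True
    then obtain m where m: "m \<noteq> j" "\<And>k. r $ k \<le> r $ m" by blast
    have "(T *v r) $ m \<le> (\<Sum>k\<in>UNIV. T $ m $ k * r $ m)"
      unfolding matrix_vector_mult_def vec_lambda_beta
    proof (rule sum_mono)
      fix k show "T $ m $ k * r $ k \<le> T $ m $ k * r $ m"
        using T m(2)[of k] by (cases "m = k") (auto simp: subintensity_def intro: mult_left_mono)
    qed
    also have "\<dots> = - exit_rates T $ m * r $ m"
      by (simp add: exit_rates_nth sum_distrib_right)
    also have "\<dots> \<le> 0"
      using nonneg[of m] T by (simp add: subintensity_def)
    finally have "(T *v r) $ m \<le> 0" .
    moreover have "\<kappa> * r $ m - (T *v r) $ m = 0"
      using arg_cong[OF eq, of "\<lambda>v. v $ m"] m(1)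
      by (simp add: matrix_vector_mult_diff_rdistrib mat_vector_mult axis_def)
    ultimately have "\<kappa> * r $ m \<le> 0" by simp
    then have "r $ m \<le> 0" using kap by (simp add: mult_le_0_iff)
    then show ?thesis using m(2)[of i] nonneg[of j] by simp
  next
    case False
    obtain m where "\<And>k. r $ k \<le> r $ m"
      using ex_is_arg_min_if_finite[of UNIV "\<lambda>j. - r $ j"] by (auto simp: is_arg_min_linorder)
    with False have "m = j" by blast
    then show ?thesis using \<open>\<And>k. r $ k \<le> r $ m\<close> by simp
  qed
  then show "matrix_inv (mat \<kappa> - T) $ i $ j \<le> matrix_inv (mat \<kappa> - T) $ j $ j"
    by (simp add: r)
  show "0 \<le> matrix_inv (mat \<kappa> - T) $ i $ j"
    by (simp add: r nonneg)
qed

text \<open>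
  The bound is the total expected time in \<open>j\<close>, which transience makes finite. It is uniform in the discount \<open>\<kappa>\<close>,
  which is what the passage \<open>\<kappa> \<rightarrow> 0\<close> below requires.
\<close>

lemma resolvent_diag_bounded:
  fixes T :: "real^'n^'n"
  assumes T: "subintensity T" and trans: "transient_state T j"
  obtains B where "\<And>\<kappa>. 0 < \<kappa> \<Longrightarrow> matrix_inv (mat \<kappa> - T) $ j $ j \<le> B"
proof
  let ?B = "enn2real (\<integral>\<^sup>+x\<in>{0..}. ennreal (matrix_exp (x *\<^sub>R T) $ j $ j) \<partial>lborel)"
  fix \<kappa> :: real assume kap: "0 < \<kappa>"
  define r where "r = matrix_inv (mat \<kappa> - T) *v axis j 1"
  have r: "matrix_inv (mat \<kappa> - T) $ i $ j = r $ i" for i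
    by (simp add: r_def matrix_vector_mul_component inner_axis)
  have eq: "(mat \<kappa> - T) *v r = axis j 1"
    unfolding r_def by (rule matrix_inv_mult[OF invertible_resolvent[OF T kap]])
  have Tr: "T *v r = \<kappa> *\<^sub>R r - axis j 1"
    using eq by (simp add: matrix_vector_mult_diff_rdistrib mat_vector_mult algebra_simps)
  define E where "E x = matrix_exp (x *\<^sub>R T)" for x
  have E_nonneg: "0 \<le> E x $ j $ j" if "0 \<le> x" for x
    unfolding E_def using matrix_exp_nonneg[OF T that] .
  have contE: "continuous_on S (\<lambda>x. E x $ j $ j)" for S
    unfolding E_def by (intro continuous_intros)
  have le: "r $ j - exp (- \<kappa> * X) * (E X *v r) $ j \<le> ?B" if X: "0 \<le> X" for X
  proof -
    have deriv: "((\<lambda>x. - (exp (- \<kappa> * x) * (E x *v r) $ j)) has_real_derivative exp (- \<kappa> * x) * E x $ j $ j) (at x within {0..X})" for x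
    proof -
      have "((\<lambda>x. (E x *v r) $ j) has_real_derivative (E x *v (T *v r)) $ j) (at x within {0..X})"
        unfolding E_def has_real_derivative_iff_has_vector_derivative
        by (intro bounded_linear.has_vector_derivative[OF bounded_linear_vec_nth] matrix_exp_vector_deriv)
      moreover have "(E x *v (T *v r)) $ j = \<kappa> * (E x *v r) $ j - E x $ j $ j"
        by (simp add: Tr matrix_vector_mult_diff_distrib matrix_vector_mult_scaleR)
          (simp add: matrix_vector_mul_component inner_axis)
      ultimately show ?thesis
        by (auto intro!: derivative_eq_intros simp: algebra_simps)
    qed
    have int: "((\<lambda>x. exp (- \<kappa> * x) * E x $ j $ j) has_integral (r $ j - exp (- \<kappa> * X) * (E X *v r) $ j)) {0..X}"
      using fundamental_theorem_of_calculus[OF X, of "\<lambda>x. - (exp (- \<kappa> * x) * (E x *v r) $ j)" "\<lambda>x. exp (- \<kappa> * x) * E x $ j $ j"] deriv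
      by (simp add: has_real_derivative_iff_has_vector_derivative E_def)
    have int2: "((\<lambda>x. E x $ j $ j) has_integral integral {0..X} (\<lambda>x. E x $ j $ j)) {0..X}"
      by (intro integrable_integral integrable_continuous_real contE)
    have "r $ j - exp (- \<kappa> * X) * (E X *v r) $ j \<le> integral {0..X} (\<lambda>x. E x $ j $ j)"
    proof (rule has_integral_le[OF int int2])
      fix x assume "x \<in> {0..X}"
      then show "exp (- \<kappa> * x) * E x $ j $ j \<le> E x $ j $ j"
        using kap E_nonneg[of x] by (intro mult_left_le_one_le) simp_all
    qed
    also have "\<dots> \<le> ?B"
    proof -
      have "ennreal (integral {0..X} (\<lambda>x. E x $ j $ j)) = (\<integral>\<^sup>+x\<in>{0..X}. ennreal (E x $ j $ j) \<partial>lborel)"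
        using nn_integral_has_integral_lebesgue'[OF _ int2] E_nonneg by simp
      also have "\<dots> \<le> (\<integral>\<^sup>+x\<in>{0..}. ennreal (matrix_exp (x *\<^sub>R T) $ j $ j) \<partial>lborel)"
        unfolding E_def by (intro nn_integral_mono) (auto split: split_indicator)
      finally have "enn2real (ennreal (integral {0..X} (\<lambda>x. E x $ j $ j))) \<le> ?B"
        using trans unfolding transient_state_def by (intro enn2real_mono) simp_all
      moreover have "0 \<le> integral {0..X} (\<lambda>x. E x $ j $ j)"
        using E_nonneg by (intro has_integral_nonneg[OF int2]) auto
      ultimately show ?thesis by simp
    qed
    finally show ?thesis .
  qed
  have bound: "\<bar>(E X *v r) $ j\<bar> \<le> (\<Sum>i\<in>UNIV. \<bar>r $ i\<bar>)" if X: "0 \<le> X" for X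
  proof -
    let ?c = "\<Sum>i\<in>UNIV. \<bar>r $ i\<bar>"
    have c: "\<bar>r $ i\<bar> \<le> ?c" for i by (rule member_le_sum) auto
    have "(E X *v (?c *\<^sub>R 1)) $ j \<le> ?c"
      using mult_left_mono[OF survival_le_1[OF T X, of j], of ?c]
      by (simp add: matrix_vector_mult_scaleR E_def sum_nonneg)
    moreover have "(E X *v r) $ j \<le> (E X *v (?c *\<^sub>R 1)) $ j"
      unfolding E_def by (rule matrix_exp_vector_mono[OF T X]) (use c abs_le_D1 in auto)
    moreover have "(E X *v (- r)) $ j \<le> (E X *v (?c *\<^sub>R 1)) $ j"
      unfolding E_def by (rule matrix_exp_vector_mono[OF T X]) (use c abs_le_D2 in auto)
    ultimately show ?thesis
      by (simp add: abs_le_iff linear_neg[OF matrix_vector_mul_linear])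
  qed
  have "((\<lambda>X. exp (- \<kappa> * X) * (E X *v r) $ j) \<longlongrightarrow> 0) at_top"
  proof (rule Lim_null_comparison)
    show "\<forall>\<^sub>F X in at_top. norm (exp (- \<kappa> * X) * (E X *v r) $ j) \<le> exp (- \<kappa> * X) * (\<Sum>i\<in>UNIV. \<bar>r $ i\<bar>)"
      using eventually_ge_at_top[of 0] by eventually_elim (use bound in \<open>auto simp: abs_mult intro!: mult_left_mono\<close>)
    have "((\<lambda>X. exp (- \<kappa> * X)) \<longlongrightarrow> 0) at_top"
      by (rule filterlim_compose[OF exp_at_bot filterlim_tendsto_neg_mult_at_bot[OF tendsto_const _ filterlim_ident]])
        (use kap in simp)
    then show "((\<lambda>X. exp (- \<kappa> * X) * (\<Sum>i\<in>UNIV. \<bar>r $ i\<bar>)) \<longlongrightarrow> 0) at_top"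
      by (rule tendsto_mult_left_zero)
  qed
  from tendsto_diff[OF tendsto_const[of "r $ j"] this] have "r $ j - 0 \<le> ?B"
  proof (rule tendsto_upperbound)
    show "\<forall>\<^sub>F X in at_top. r $ j - exp (- \<kappa> * X) * (E X *v r) $ j \<le> ?B"
      using eventually_ge_at_top[of 0] by eventually_elim (rule le)
  qed simp
  then show "matrix_inv (mat \<kappa> - T) $ j $ j \<le> ?B" by (simp add: r)
qed

text \<open>
  Since \<open>(\<kappa> - T) h \<le> \<kappa> h\<close>, applying the nonnegative resolvent \<open>R\<close> gives \<open>h \<le> \<kappa> R h\<close>. For a transient chain
  \<open>R\<close> stays bounded as \<open>\<kappa> \<rightarrow> 0\<close>, so the right-hand side vanishes in the limit.
\<close>

lemma transient_max_principle:
  fixes T :: "real^'n^'n"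
  assumes T: "subintensity T" and trans: "\<And>j. transient_state T j"
    and h: "\<And>i. 0 \<le> (T *v h) $ i"
  shows "h $ i \<le> 0"
proof -
  have "\<exists>B. \<forall>\<kappa>>0. matrix_inv (mat \<kappa> - T) $ j $ j \<le> B" for j
    using resolvent_diag_bounded[OF T trans] by metis
  then obtain B where B: "\<And>j \<kappa>. 0 < \<kappa> \<Longrightarrow> matrix_inv (mat \<kappa> - T) $ j $ j \<le> B j"
    by metis
  let ?C = "\<Sum>j\<in>UNIV. B j * \<bar>h $ j\<bar>"
  have le: "h $ i \<le> \<kappa> * ?C" if kap: "0 < \<kappa>" for \<kappa>
  proof -
    let ?R = "matrix_inv (mat \<kappa> - T)"
    have "0 \<le> (\<kappa> *\<^sub>R (?R *v h) - h) $ i"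
    proof (rule resolvent_max_principle[OF T kap])
      fix i
      have "(mat \<kappa> - T) *v (\<kappa> *\<^sub>R (?R *v h) - h) = T *v h"
        by (simp add: matrix_vector_mult_diff_distrib matrix_vector_mult_scaleR
           matrix_inv_mult[OF invertible_resolvent[OF T kap]])
           (simp add: matrix_vector_mult_diff_rdistrib mat_vector_mult)
      then show "0 \<le> ((mat \<kappa> - T) *v (\<kappa> *\<^sub>R (?R *v h) - h)) $ i" using h by simp
    qed
    moreover have "(?R *v h) $ i \<le> ?C"
      unfolding matrix_vector_mult_def vec_lambda_beta
    proof (rule sum_mono)
      fix j
      have "?R $ i $ j * h $ j \<le> ?R $ i $ j * \<bar>h $ j\<bar>"
        by (intro mult_left_mono resolvent_entry_le_diag[OF T kap]) auto
      also have "\<dots> \<le> B j * \<bar>h $ j\<bar>"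
        by (intro mult_right_mono order_trans[OF resolvent_entry_le_diag(2)[OF T kap] B[OF kap]]) auto
      finally show "?R $ i $ j * h $ j \<le> B j * \<bar>h $ j\<bar>" .
    qed
    ultimately show ?thesis
      using kap by (simp add: order_trans[OF _ mult_left_mono])
  qed
  have "((\<lambda>\<kappa>. \<kappa> * ?C) \<longlongrightarrow> 0 * ?C) (at_right 0)"
    by (intro tendsto_intros)
  then show ?thesis
    using tendsto_lowerbound[of "\<lambda>\<kappa>. \<kappa> * ?C" "0 * ?C" "at_right 0" "h $ i"]
      eventually_mono[OF eventually_at_right_less[of "0::real"], of "\<lambda>\<kappa>. h $ i \<le> \<kappa> * ?C"] le
    by (simp add: trivial_limit_at_right_real)
qed

section \<open>Exponential tilting\<close>

lemma phase_type_params_subintensity: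
  "phase_type_params T \<nu> \<Longrightarrow> subintensity T"
  by (simp add: phase_type_params_def subintensity_def exit_rates_nth)

text \<open>
  The entry \<open>u i\<close> is the Laplace transform at \<open>\<theta>\<close> of the life time started in \<open>i\<close>. The set where \<open>u\<close> vanishes
  cannot be left, neither to other states nor by absorption, so its indicator \<open>h\<close> satisfies \<open>T h \<ge> 0\<close>; a transient
  chain has no such nonempty set. The upper bound holds because \<open>(\<theta> - T) (1 - u) = \<theta> 1\<close>.
\<close>

lemma exit_transform_bounds:
  fixes T :: "real^'n^'n"
  assumes T: "subintensity T" and trans: "\<And>j. transient_state T j" and \<theta>: "0 < \<theta>"
  defines "u \<equiv> matrix_inv (mat \<theta> - T) *v exit_rates T"
  shows "(mat \<theta> - T) *v u = exit_rates T" and "0 < u $ i" and "u $ i < 1"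
proof -
  show eq: "(mat \<theta> - T) *v u = exit_rates T"
    unfolding u_def by (rule matrix_inv_mult[OF invertible_resolvent[OF T \<theta>]])
  have eq': "\<theta> * u $ i - (\<Sum>j\<in>UNIV. T $ i $ j * u $ j) = exit_rates T $ i" for i
    using arg_cong[OF eq, of "\<lambda>v. v $ i"]
    by (simp only: matrix_vector_mult_diff_rdistrib mat_vector_mult) (simp add: matrix_vector_mult_def)
  have off: "0 \<le> T $ i $ j" if "i \<noteq> j" for i j
    using T that by (simp add: subintensity_def)
  have exit: "0 \<le> exit_rates T $ i" for i
    using T by (simp add: subintensity_def)
  have nonneg: "0 \<le> u $ i" for i
    by (rule resolvent_max_principle[OF T \<theta>]) (simp add: eq exit)
  define h :: "real^'n" where "h = (\<chi> i. if u $ i = 0 then 1 else 0)"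
  have "0 \<le> (T *v h) $ i" for i
  proof (cases "u $ i = 0")
    case True
    have terms: "0 \<le> T $ i $ j * u $ j" for j
      using off[of i j] nonneg[of j] True by (cases "i = j") auto
    then have "0 \<le> (\<Sum>j\<in>UNIV. T $ i $ j * u $ j)"
      by (intro sum_nonneg) auto
    with eq'[of i] exit[of i] True have "(\<Sum>j\<in>UNIV. T $ i $ j * u $ j) = 0" and exit0: "exit_rates T $ i = 0"
      by auto
    then have zero: "T $ i $ j * u $ j = 0" for j
      using terms by (subst (asm) sum_nonneg_eq_0_iff) auto
    have "T $ i $ j * h $ j = T $ i $ j" for j
      using zero[of j] by (auto simp: h_def)
    then have "(T *v h) $ i = - exit_rates T $ i"
      by (simp only: matrix_vector_mult_def exit_rates_nth vec_lambda_beta minus_minus)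
    then show ?thesis using exit0 by simp
  next
    case False
    then have "0 \<le> T $ i $ j * h $ j" for j
      using off[of i j] by (cases "i = j") (auto simp: h_def)
    then show ?thesis
      by (simp add: matrix_vector_mult_def sum_nonneg)
  qed
  from transient_max_principle[OF T trans this] have "h $ i \<le> 0" .
  then show "0 < u $ i"
    using nonneg[of i] by (cases "u $ i = 0") (auto simp: h_def)
  have eq1: "(mat \<theta> - T) *v (1 - u) = \<theta> *\<^sub>R 1"
    by (simp add: matrix_vector_mult_diff_distrib eq)
       (simp add: matrix_vector_mult_diff_rdistrib mat_vector_mult exit_rates_def)
  have le: "0 \<le> (1 - u) $ i" for i
    by (rule resolvent_max_principle[OF T \<theta>]) (simp only: eq1, use \<theta> in simp)
  show "u $ i < 1"
  proof (rule ccontr)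
    assume "\<not> u $ i < 1"
    with le[of i] have 1: "u $ i = 1" by simp
    have "(\<Sum>j\<in>UNIV. T $ i $ j * u $ j) \<le> (\<Sum>j\<in>UNIV. T $ i $ j)"
    proof (rule sum_mono)
      fix j show "T $ i $ j * u $ j \<le> T $ i $ j"
        using off[of i j] le[of j] 1 by (cases "i = j") (auto intro: mult_left_le)
    qed
    with eq'[of i] 1 \<theta> show False by (simp add: exit_rates_nth)
  qed
qed

lemma matrix_inv_unique_left:
  assumes "B ** A = mat 1"
  shows "matrix_inv (A :: real^'n^'n) = B"
proof -
  have "A ** B = mat 1" using assms by (simp only: matrix_left_right_inverse)
  then have "invertible A" using assms by (auto simp: invertible_def)
  from matrix_inv_inverse(1)[OF this] have "B ** (A ** matrix_inv A) = B" by simp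
  then show ?thesis by (simp add: matrix_mul_assoc assms)
qed

lemma diag_matrix_mult:
  "diag_matrix u ** A = (\<chi> i j. u $ i * A $ i $ j)" "A ** diag_matrix u = (\<chi> i j. A $ i $ j * u $ j)"
  "diag_matrix u *v w = (\<chi> i. u $ i * w $ i)" "w v* diag_matrix u = (\<chi> i. w $ i * u $ i)"
  for u w :: "real^'n" and A :: "real^'n^'n"
  by (simp_all add: vec_eq_iff matrix_matrix_mult_def matrix_vector_mult_def vector_matrix_mult_def diag_matrix_def
      if_distrib if_distribR cong: if_cong)

lemma matrix_inv_diag_matrix:
  assumes "\<And>i. u $ i \<noteq> 0"
  shows "matrix_inv (diag_matrix u) = diag_matrix (\<chi> i. inverse (u $ i))"
  by (rule matrix_inv_unique_left)
    (simp add: diag_matrix_mult, simp add: vec_eq_iff diag_matrix_def mat_def assms)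

text \<open>
  Conjugation by \<open>diag u\<close> is the Doob transform with the positive function \<open>u\<close>, which solves \<open>T u = \<theta> u - t\<close>.
  It carries \<open>exp (x T)\<close> to \<open>e\<^sup>-\<^sup>\<theta>\<^sup>x (diag u)\<^sup>-\<^sup>1 exp (x T) diag u\<close>, from which the density can be read off;
  transience is inherited because the diagonal entries only decrease.
\<close>

lemma exponential_tilting:
  fixes T :: "real^'n^'n" and \<nu> :: "real^'n"
  assumes PH: "phase_type_params T \<nu>" and \<theta>: "0 < \<theta>"
  defines "u \<equiv> matrix_inv (mat \<theta> - T) *v exit_rates T"
  defines "G \<equiv> \<nu> \<bullet> u"
  defines "\<Delta> \<equiv> diag_matrix u"
  defines "T' \<equiv> matrix_inv \<Delta> ** T ** \<Delta> - mat \<theta>"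
  defines "\<nu>' \<equiv> (1 / G) *\<^sub>R (\<nu> v* \<Delta>)"
  shows "0 < G" "G < 1"
    and "phase_type_params T' \<nu>'"
    and "exit_rates T' = matrix_inv \<Delta> *v exit_rates T"
    and "phase_type_density T' \<nu>' = (\<lambda>x. 1 / G * exp (- \<theta> * x) * phase_type_density T \<nu> x)"
proof -
  note T = phase_type_params_subintensity[OF PH]
  have trans: "transient_state T j" for j using PH by (simp add: phase_type_params_def)
  have eq: "(mat \<theta> - T) *v u = exit_rates T" and u_pos: "0 < u $ i" and u_less: "u $ i < 1" for i
    unfolding u_def by (rule exit_transform_bounds[OF T trans \<theta>])+
  have \<nu>: "0 \<le> \<nu> $ i" "(\<Sum>i\<in>UNIV. \<nu> $ i) = 1" for i
    using PH by (auto simp: phase_type_params_def)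
  have u_ne [simp]: "u $ i \<noteq> 0" for i using u_pos[of i] by simp
  obtain k where k: "0 < \<nu> $ k"
    using \<nu> sum_nonpos[of UNIV "\<lambda>i. \<nu> $ i"] by (metis not_less zero_less_one)
  have G: "G = (\<Sum>i\<in>UNIV. \<nu> $ i * u $ i)" by (simp add: G_def inner_vec_def)
  show G_pos: "0 < G"
    unfolding G using k u_pos \<nu> by (intro sum_pos2[of UNIV k]) (auto simp: less_imp_le)
  have "(\<Sum>i\<in>UNIV. \<nu> $ i * u $ i) < (\<Sum>i\<in>UNIV. \<nu> $ i)"
  proof (rule sum_strict_mono_ex1)
    show "\<forall>i\<in>UNIV. \<nu> $ i * u $ i \<le> \<nu> $ i"
      using \<nu>(1) u_less by (auto intro!: mult_left_le simp: less_imp_le)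
    show "\<exists>i\<in>UNIV. \<nu> $ i * u $ i < \<nu> $ i"
      using k u_less[of k] by (intro bexI[of _ k]) auto
  qed simp
  then show "G < 1" by (simp add: G \<nu>)
  have inv: "matrix_inv \<Delta> = diag_matrix (\<chi> i. inverse (u $ i))"
    unfolding \<Delta>_def by (rule matrix_inv_diag_matrix) simp
  have inv1: "matrix_inv \<Delta> ** \<Delta> = mat 1" "\<Delta> ** matrix_inv \<Delta> = mat 1"
    unfolding inv unfolding \<Delta>_def by (simp_all add: diag_matrix_mult) (simp_all add: vec_eq_iff diag_matrix_def mat_def)
  have conj: "(matrix_inv \<Delta> ** A ** \<Delta>) $ i $ j = A $ i $ j * u $ j / u $ i" for A i j
    unfolding inv unfolding \<Delta>_def by (simp add: diag_matrix_mult field_simps)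
  have Tu: "T *v u = \<theta> *\<^sub>R u - exit_rates T"
    using eq by (simp add: matrix_vector_mult_diff_rdistrib mat_vector_mult algebra_simps)
  have "\<Delta> *v 1 = u"
    by (simp add: \<Delta>_def diag_matrix_mult vec_eq_iff)
  then have "T' *v 1 = matrix_inv \<Delta> *v (\<theta> *\<^sub>R u - exit_rates T) - \<theta> *\<^sub>R 1"
    by (simp add: T'_def matrix_vector_mult_diff_rdistrib mat_vector_mult Tu matrix_vector_mul_assoc[symmetric])
  also have "\<dots> = - (matrix_inv \<Delta> *v exit_rates T)"
    by (simp add: inv diag_matrix_mult vec_eq_iff algebra_simps)
  finally show exit: "exit_rates T' = matrix_inv \<Delta> *v exit_rates T"
    by (simp add: exit_rates_def)
  have exp: "matrix_exp (x *\<^sub>R T') = exp (- \<theta> * x) *\<^sub>R (matrix_inv \<Delta> ** matrix_exp (x *\<^sub>R T) ** \<Delta>)" for x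
  proof (rule matrix_exp_uniq[symmetric])
    fix x
    let ?E = "matrix_exp (x *\<^sub>R T)"
    note mult_deriv = bounded_linear.has_vector_derivative[OF bounded_bilinear.bounded_linear_right[OF bounded_bilinear_matrix_matrix_mult]]
      bounded_linear.has_vector_derivative[OF bounded_bilinear.bounded_linear_left[OF bounded_bilinear_matrix_matrix_mult]]
    have "((\<lambda>x. exp (- \<theta> * x) *\<^sub>R (matrix_inv \<Delta> ** matrix_exp (x *\<^sub>R T) ** \<Delta>)) has_vector_derivative
       exp (- \<theta> * x) *\<^sub>R (matrix_inv \<Delta> ** (T ** ?E) ** \<Delta>)
         + (exp (- \<theta> * x) * (- \<theta>)) *\<^sub>R (matrix_inv \<Delta> ** ?E ** \<Delta>)) (at x)"
      by (rule has_vector_derivative_scaleR[OF _ mult_deriv(2)[OF mult_deriv(1)[OF matrix_exp_deriv]]])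
        (auto intro!: derivative_eq_intros)
    moreover have "T' ** (exp (- \<theta> * x) *\<^sub>R (matrix_inv \<Delta> ** ?E ** \<Delta>)) =
       exp (- \<theta> * x) *\<^sub>R (matrix_inv \<Delta> ** (T ** ?E) ** \<Delta>)
         + (exp (- \<theta> * x) * (- \<theta>)) *\<^sub>R (matrix_inv \<Delta> ** ?E ** \<Delta>)"
    proof -
      have "(matrix_inv \<Delta> ** T ** \<Delta>) ** (matrix_inv \<Delta> ** ?E ** \<Delta>) = matrix_inv \<Delta> ** T ** (\<Delta> ** matrix_inv \<Delta>) ** ?E ** \<Delta>"
        by (simp only: matrix_mul_assoc)
      then show ?thesis
        by (simp add: T'_def bounded_bilinear.diff_left[OF bounded_bilinear_matrix_matrix_mult]
          bounded_bilinear.scaleR_right[OF bounded_bilinear_matrix_matrix_mult]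
          bounded_bilinear.scaleR_left[OF bounded_bilinear_matrix_matrix_mult] inv1 mat_matrix_mult matrix_mul_assoc scaleR_diff_right)
    qed
    ultimately show "((\<lambda>x. exp (- \<theta> * x) *\<^sub>R (matrix_inv \<Delta> ** matrix_exp (x *\<^sub>R T) ** \<Delta>)) has_vector_derivative
       T' ** (exp (- \<theta> * x) *\<^sub>R (matrix_inv \<Delta> ** ?E ** \<Delta>))) (at x)" by simp
  qed (simp add: inv1)
  have "transient_state T' j" for j
  proof -
    have "(\<integral>\<^sup>+x\<in>{0..}. ennreal (matrix_exp (x *\<^sub>R T') $ j $ j) \<partial>lborel)
       \<le> (\<integral>\<^sup>+x\<in>{0..}. ennreal (matrix_exp (x *\<^sub>R T) $ j $ j) \<partial>lborel)"
    proof (intro nn_integral_mono)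
      fix x
      show "ennreal (matrix_exp (x *\<^sub>R T') $ j $ j) * indicator {0..} x \<le> ennreal (matrix_exp (x *\<^sub>R T) $ j $ j) * indicator {0..} x"
      proof (cases "0 \<le> x")
        case True
        have "matrix_exp (x *\<^sub>R T') $ j $ j = exp (- \<theta> * x) * matrix_exp (x *\<^sub>R T) $ j $ j"
          by (simp add: exp conj)
        also have "\<dots> \<le> matrix_exp (x *\<^sub>R T) $ j $ j"
          using \<theta> True by (intro mult_left_le_one_le matrix_exp_nonneg[OF T]) simp_all
        finally show ?thesis by (auto intro!: mult_right_mono ennreal_leI)
      qed simp
    qed
    also have "\<dots> < \<infinity>" using trans[of j] by (simp only: transient_state_def)
    finally show ?thesis by (simp only: transient_state_def)
  qed
  moreover have "0 \<le> T' $ i $ j" if "i \<noteq> j" for i j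
    using that T u_pos by (simp add: T'_def conj mat_def subintensity_def less_imp_le)
  moreover have "(\<Sum>j\<in>UNIV. T' $ i $ j) \<le> 0" for i
  proof -
    have "0 \<le> exit_rates T' $ i"
      unfolding exit using T u_pos by (simp add: inv diag_matrix_mult subintensity_def less_imp_le)
    then show ?thesis by (simp add: exit_rates_nth)
  qed
  moreover have "0 \<le> \<nu>' $ i" "(\<Sum>i\<in>UNIV. \<nu>' $ i) = 1" for i
    using \<nu> u_pos G_pos by (simp_all add: \<nu>'_def \<Delta>_def diag_matrix_mult less_imp_le G flip: sum_divide_distrib)
  ultimately show "phase_type_params T' \<nu>'"
    by (simp add: phase_type_params_def)
  show "phase_type_density T' \<nu>' = (\<lambda>x. 1 / G * exp (- \<theta> * x) * phase_type_density T \<nu> x)"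
  proof
    fix x
    let ?E = "matrix_exp (x *\<^sub>R T)"
    have exit': "exit_rates T' $ j = exit_rates T $ j / u $ j" for j
      unfolding exit inv by (simp add: diag_matrix_mult field_simps)
    have entry: "matrix_exp (x *\<^sub>R T') $ i $ j = exp (- \<theta> * x) * (?E $ i $ j * u $ j / u $ i)" for i j
      by (simp add: exp conj)
    have "(matrix_exp (x *\<^sub>R T') *v exit_rates T') $ i = (\<Sum>j\<in>UNIV. exp (- \<theta> * x) / u $ i * (?E $ i $ j * exit_rates T $ j))" for i
      unfolding matrix_vector_mult_def vec_lambda_beta by (intro sum.cong refl) (simp add: entry exit')
    then have vec: "(matrix_exp (x *\<^sub>R T') *v exit_rates T') $ i = exp (- \<theta> * x) / u $ i * (?E *v exit_rates T) $ i" for i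
      by (simp only: matrix_vector_mult_def vec_lambda_beta sum_distrib_left)
    have \<nu>'_nth: "\<nu>' $ i = \<nu> $ i * u $ i / G" for i
      by (simp add: \<nu>'_def \<Delta>_def diag_matrix_mult)
    have "\<nu>' \<bullet> (matrix_exp (x *\<^sub>R T') *v exit_rates T') = (\<Sum>i\<in>UNIV. 1 / G * exp (- \<theta> * x) * (\<nu> $ i * (?E *v exit_rates T) $ i))"
      unfolding inner_vec_def by (intro sum.cong refl) (simp only: vec \<nu>'_nth inner_real_def, simp)
    also have "\<dots> = 1 / G * exp (- \<theta> * x) * (\<nu> \<bullet> (?E *v exit_rates T))"
      by (simp only: inner_vec_def inner_real_def sum_distrib_left)
    finally have "\<nu>' \<bullet> (matrix_exp (x *\<^sub>R T') *v exit_rates T') = 1 / G * exp (- \<theta> * x) * (\<nu> \<bullet> (matrix_exp (x *\<^sub>R T) *v exit_rates T))"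
      .
    then show "phase_type_density T' \<nu>' x = 1 / G * exp (- \<theta> * x) * phase_type_density T \<nu> x"
      by (simp add: phase_type_density_def)
  qed
qed

section \<open>Laplace transforms of real functions\<close>

text \<open>
  Stating convergence and value together lets the transform be computed by introduction rules.
\<close>

definition has_laplace :: "(real \<Rightarrow> real) \<Rightarrow> real \<Rightarrow> real \<Rightarrow> bool" where
  "has_laplace \<phi> s L \<longleftrightarrow> has_bochner_integral lborel (\<lambda>x. indicator {0..} x * (exp (- s * x) * \<phi> x)) L"

lemma has_laplace_cmult: "has_laplace \<phi> s L \<Longrightarrow> has_laplace (\<lambda>x. c * \<phi> x) s (c * L)"
  unfolding has_laplace_def using has_bochner_integral_mult_right[of c]
  by (auto simp: mult.left_commute)

lemma has_laplace_add: "has_laplace \<phi> s L \<Longrightarrow> has_laplace \<psi> s M \<Longrightarrow> has_laplace (\<lambda>x. \<phi> x + \<psi> x) s (L + M)"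
  unfolding has_laplace_def by (auto dest: has_bochner_integral_add simp: distrib_left)

lemma has_laplace_diff: "has_laplace \<phi> s L \<Longrightarrow> has_laplace \<psi> s M \<Longrightarrow> has_laplace (\<lambda>x. \<phi> x - \<psi> x) s (L - M)"
  unfolding has_laplace_def by (auto dest: has_bochner_integral_diff simp: right_diff_distrib)

lemma has_laplace_sum:
  "(\<And>i. i \<in> I \<Longrightarrow> has_laplace (\<phi> i) s (L i)) \<Longrightarrow> has_laplace (\<lambda>x. \<Sum>i\<in>I. \<phi> i x) s (\<Sum>i\<in>I. L i)"
  unfolding has_laplace_def sum_distrib_left by (rule has_bochner_integral_sum)

lemma has_laplace_shift:
  assumes "has_laplace \<phi> s L" "0 \<le> d"
  shows "has_laplace (\<lambda>x. if d \<le> x then \<phi> (x - d) else 0) s (exp (- s * d) * L)"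
proof -
  have "has_bochner_integral lborel (\<lambda>x. indicator {0..} (- d + 1 * x) * (exp (- s * (- d + 1 * x)) * \<phi> (- d + 1 * x))) (L /\<^sub>R \<bar>1\<bar>)"
    using assms(1) unfolding has_laplace_def by (subst (asm) lborel_has_bochner_integral_real_affine_iff[of 1 _ _ "- d"]) auto
  from has_bochner_integral_mult_right[OF this, of "exp (- s * d)"]
  have "has_bochner_integral lborel (\<lambda>x. exp (- s * d) * (indicator {0..} (x - d) * (exp (- s * (x - d)) * \<phi> (x - d)))) (exp (- s * d) * L)"
    by simp
  also have "(\<lambda>x. exp (- s * d) * (indicator {0..} (x - d) * (exp (- s * (x - d)) * \<phi> (x - d)))) =
     (\<lambda>x. indicator {0..} x * (exp (- s * x) * (if d \<le> x then \<phi> (x - d) else 0)))"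
  proof
    fix x
    have "exp (- s * d) * exp (- s * (x - d)) = exp (- s * x)"
      by (simp add: mult_exp_exp right_diff_distrib)
    then have "exp (- s * d) * (exp (- s * (x - d)) * \<phi> (x - d)) = exp (- s * x) * \<phi> (x - d)"
      by (simp only: mult.assoc[symmetric])
    then show "exp (- s * d) * (indicator {0..} (x - d) * (exp (- s * (x - d)) * \<phi> (x - d))) =
        indicator {0..} x * (exp (- s * x) * (if d \<le> x then \<phi> (x - d) else 0))"
      using assms(2) by (cases "d \<le> x") (simp_all add: indicator_def)
  qed
  finally show ?thesis unfolding has_laplace_def .
qed

lemma has_bochner_integral_exp_tail:
  fixes s :: real
  assumes s: "0 < s"
  shows "has_bochner_integral lborel (\<lambda>x. indicator {z..} x * exp (- s * x)) (exp (- s * z) / s)"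
proof (rule has_bochner_integral_nn_integral)
  have "((\<lambda>x. exp (- s * x)) \<longlongrightarrow> 0) at_top"
    by (rule filterlim_compose[OF exp_at_bot filterlim_tendsto_neg_mult_at_bot[OF tendsto_const _ filterlim_ident]])
      (use s in simp)
  then have lim: "((\<lambda>x. - exp (- s * x) / s) \<longlongrightarrow> - 0 / s) at_top"
    by (intro tendsto_intros) (use s in auto)
  have "(\<integral>\<^sup>+x. ennreal (exp (- s * x)) * indicator {z..} x \<partial>lborel) = ennreal (- 0 / s - (- exp (- s * z) / s))"
    by (rule nn_integral_FTC_atLeast[OF _ _ _ lim]) (use s in \<open>auto intro!: derivative_eq_intros\<close>)
  also have "(\<integral>\<^sup>+x. ennreal (exp (- s * x)) * indicator {z..} x \<partial>lborel) = (\<integral>\<^sup>+x. ennreal (indicator {z..} x * exp (- s * x)) \<partial>lborel)"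
    by (intro nn_integral_cong) (auto split: split_indicator)
  finally show "(\<integral>\<^sup>+x. ennreal (indicator {z..} x * exp (- s * x)) \<partial>lborel) = ennreal (exp (- s * z) / s)"
    by simp
qed (use s in auto)

lemma has_laplace_const:
  assumes "0 < s"
  shows "has_laplace (\<lambda>x. c) s (c / s)"
  using has_bochner_integral_mult_left[OF has_bochner_integral_exp_tail[OF assms, of 0], of c]
  unfolding has_laplace_def by (simp add: mult.assoc)

text \<open>
  Fubini's theorem for the kernel \<open>\<phi> z e\<^sup>-\<^sup>s\<^sup>y\<close> on \<open>0 \<le> z \<le> y\<close>, whose integral over \<open>y\<close> is
  \<open>\<phi> z e\<^sup>-\<^sup>s\<^sup>z / s\<close>.
\<close>

lemma has_laplace_integral:
  assumes cont: "continuous_on {0..} \<phi>" and L: "has_laplace \<phi> s L" and s: "0 < s"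
  shows "has_laplace (\<lambda>x. integral {0..x} \<phi>) s (L / s)"
proof -
  define \<psi> where "\<psi> z = indicator {0..} z * \<phi> z" for z :: real
  define k where "k z y = \<psi> z * (indicator {z..} y * exp (- s * y))" for z y :: real
  have "(\<lambda>z. indicator {0..} z *\<^sub>R \<phi> z) \<in> borel_measurable borel"
    by (rule borel_measurable_continuous_on_indicator[OF _ cont]) simp
  then have [measurable]: "\<psi> \<in> borel_measurable borel"
    unfolding \<psi>_def by simp
  have [measurable]: "case_prod k \<in> borel_measurable (lborel \<Otimes>\<^sub>M lborel)"
  proof -
    have "(\<lambda>(z, y). \<psi> z * ((if z \<le> y then 1 else 0) * exp (- s * y))) \<in> borel_measurable (lborel \<Otimes>\<^sub>M lborel)"
      by measurable
    also have "(\<lambda>(z, y). \<psi> z * ((if z \<le> y then 1 else 0) * exp (- s * y))) = case_prod k"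
      by (auto simp: k_def fun_eq_iff indicator_def)
    finally show ?thesis .
  qed
  have L': "has_bochner_integral lborel (\<lambda>z. \<psi> z * (exp (- s * z) / s)) (L / s)"
    using has_bochner_integral_mult_right[OF L[unfolded has_laplace_def], of "1 / s"]
    by (simp add: \<psi>_def mult_ac)
  have k_int: "has_bochner_integral lborel (k z) (\<psi> z * (exp (- s * z) / s))" for z
    unfolding k_def by (rule has_bochner_integral_mult_right[OF has_bochner_integral_exp_tail[OF s]])
  have "has_bochner_integral lborel (\<lambda>y. norm (k z y)) (norm (\<psi> z * (exp (- s * z) / s)))" for z
    using has_bochner_integral_mult_right[OF has_bochner_integral_exp_tail[OF s, of z], of "\<bar>\<psi> z\<bar>"] s
    by (simp add: k_def abs_mult)
  then have k_norm: "(\<integral>y. norm (k z y) \<partial>lborel) = norm (\<psi> z * (exp (- s * z) / s))" for z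
    by (rule has_bochner_integral_integral_eq)
  have int: "integrable (lborel \<Otimes>\<^sub>M lborel) (case_prod k)"
  proof (rule lborel_pair.Fubini_integrable)
    show "integrable lborel (\<lambda>x. LINT y|lborel. norm (case (x, y) of (x, xa) \<Rightarrow> k x xa))"
      using L' by (simp only: prod.case k_norm integrable_norm has_bochner_integral_iff)
    show "AE x in lborel. integrable lborel (\<lambda>y. case (x, y) of (x, xa) \<Rightarrow> k x xa)"
      using k_int by (auto simp: has_bochner_integral_iff)
  qed measurable
  have inner: "(\<integral>z. k z y \<partial>lborel) = indicator {0..} y * (exp (- s * y) * integral {0..y} \<phi>)" for y
  proof (cases "0 \<le> y")
    case True
    have "set_integrable lborel {0..y} \<phi>"
      by (rule borel_integrable_atLeastAtMost') (rule continuous_on_subset[OF cont], auto)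
    from set_borel_integral_eq_integral(2)[OF this]
    have "exp (- s * y) * integral {0..y} \<phi> = (\<integral>z. exp (- s * y) * (indicator {0..y} z * \<phi> z) \<partial>lborel)"
      by (simp add: set_lebesgue_integral_def)
    also have "\<dots> = (\<integral>z. k z y \<partial>lborel)"
      by (intro Bochner_Integration.integral_cong) (auto simp: k_def \<psi>_def split: split_indicator)
    finally show ?thesis using True by simp
  next
    case False
    then have "k z y = 0" for z by (auto simp: k_def \<psi>_def split: split_indicator)
    then show ?thesis using False by simp
  qed
  have "(\<integral>y. (\<integral>z. k z y \<partial>lborel) \<partial>lborel) = (\<integral>z. (\<integral>y. k z y \<partial>lborel) \<partial>lborel)"
    by (rule lborel_pair.Fubini_integral[OF int])
  also have "\<dots> = L / s"
    using L' by (simp add: has_bochner_integral_integral_eq[OF k_int] has_bochner_integral_iff)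
  finally show ?thesis
    using lborel_pair.integrable_snd[OF int] unfolding has_laplace_def has_bochner_integral_iff inner by simp
qed

text \<open>
  Lerch's theorem. In the variable \<open>u = e\<^sup>-\<^sup>x\<close> the transform at the points \<open>s\<^sub>1 + n\<close> gives the moments of the
  integrable function \<open>h(x) = exp (- s\<^sub>1 x) \<phi> x\<close>. As they all vanish, so do its integrals against continuous
  functions of \<open>u\<close>, by Weierstrass approximation; a bump around a point where \<open>\<phi>\<close> is nonzero gives a contradiction.
\<close>

lemma laplace_unique:
  fixes \<phi> :: "real \<Rightarrow> real"
  assumes cont: "continuous_on {0..} \<phi>" and L: "\<And>s. s\<^sub>0 < s \<Longrightarrow> has_laplace \<phi> s 0" and x: "0 \<le> x"
  shows "\<phi> x = 0"
proof -
  define s\<^sub>1 where "s\<^sub>1 = s\<^sub>0 + 1"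
  define h where "h x = indicator {0..} x * (exp (- s\<^sub>1 * x) * \<phi> x)" for x
  have h: "integrable lborel h"
    using L[of s\<^sub>1] by (simp add: has_laplace_def h_def[abs_def] s\<^sub>1_def has_bochner_integral_iff)
  then have [measurable]: "h \<in> borel_measurable borel" by simp
  have powers: "has_bochner_integral lborel (\<lambda>x. exp (- x) ^ n * h x) 0" for n
  proof -
    have "exp (- x) ^ n * exp (- s\<^sub>1 * x) = exp (- (s\<^sub>1 + real n) * x)" for x
      by (simp add: exp_of_nat_mult[symmetric] mult_exp_exp algebra_simps)
    then have "exp (- x) ^ n * h x = indicator {0..} x * (exp (- (s\<^sub>1 + real n) * x) * \<phi> x)" for x
      unfolding h_def by (metis mult.assoc mult.left_commute)
    then have "(\<lambda>x. exp (- x) ^ n * h x) = (\<lambda>x. indicator {0..} x * (exp (- (s\<^sub>1 + real n) * x) * \<phi> x))"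
      by (rule ext)
    with L[of "s\<^sub>1 + real n"] show ?thesis
      by (simp add: has_laplace_def s\<^sub>1_def)
  qed
  have poly: "has_bochner_integral lborel (\<lambda>x. p (exp (- x)) * h x) 0" if p: "real_polynomial_function p" for p
  proof -
    obtain a n where "p = (\<lambda>x. \<Sum>i\<le>n. a i * x ^ i)"
      using p by (auto simp: real_polynomial_function_iff_sum)
    moreover have "has_bochner_integral lborel (\<lambda>x. \<Sum>i\<le>n. a i * (exp (- x) ^ i * h x)) (\<Sum>i\<le>n. a i * 0)"
      by (intro has_bochner_integral_sum has_bochner_integral_mult_right powers)
    ultimately show ?thesis
      by (simp add: sum_distrib_right mult.assoc)
  qed
  have test: "(\<integral>x. \<psi> (exp (- x)) * h x \<partial>lborel) = 0" and test_int: "integrable lborel (\<lambda>x. \<psi> (exp (- x)) * h x)"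
    if \<psi>: "continuous_on UNIV \<psi>" for \<psi> :: "real \<Rightarrow> real"
  proof -
    have [measurable]: "\<psi> \<in> borel_measurable borel" by (rule borel_measurable_continuous_onI[OF \<psi>])
    have approx: "\<exists>p. real_polynomial_function p \<and> (\<forall>x. \<bar>\<psi> (exp (- x)) * h x - p (exp (- x)) * h x\<bar> \<le> e * \<bar>h x\<bar>)" if e: "0 < e" for e
    proof -
      obtain p where p: "real_polynomial_function p" "\<And>u. u \<in> {0..1} \<Longrightarrow> \<bar>\<psi> u - p u\<bar> < e"
        using Stone_Weierstrass_real_polynomial_function[of "{0..1}" \<psi> e] e continuous_on_subset[OF \<psi>, of "{0..1}"] by auto
      have "\<bar>\<psi> (exp (- x)) * h x - p (exp (- x)) * h x\<bar> \<le> e * \<bar>h x\<bar>" for x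
      proof (cases "0 \<le> x")
        case True
        then have "\<bar>\<psi> (exp (- x)) - p (exp (- x))\<bar> \<le> e" using p(2)[of "exp (- x)"] by simp
        then show ?thesis by (simp add: left_diff_distrib[symmetric] abs_mult mult_right_mono)
      qed (simp add: h_def)
      with p(1) show ?thesis by blast
    qed
    show int: "integrable lborel (\<lambda>x. \<psi> (exp (- x)) * h x)"
    proof -
      obtain p where p: "real_polynomial_function p" "\<And>x. \<bar>\<psi> (exp (- x)) * h x - p (exp (- x)) * h x\<bar> \<le> 1 * \<bar>h x\<bar>"
        using approx[of 1] by auto
      have p_int: "integrable lborel (\<lambda>x. p (exp (- x)) * h x)"
        using poly[OF p(1)] by (simp add: has_bochner_integral_iff)
      have "integrable lborel (\<lambda>x. \<psi> (exp (- x)) * h x - p (exp (- x)) * h x)"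
        by (rule Bochner_Integration.integrable_bound[OF h]) (use p p_int in auto)
      from Bochner_Integration.integrable_add[OF this p_int] show ?thesis by simp
    qed
    have "\<bar>\<integral>x. \<psi> (exp (- x)) * h x \<partial>lborel\<bar> \<le> 0 + e" if e: "0 < e" for e
    proof -
      define c where "c = (\<integral>x. \<bar>h x\<bar> \<partial>lborel) + 1"
      have c: "0 < c" unfolding c_def by (rule add_nonneg_pos) auto
      obtain p where p: "real_polynomial_function p" "\<And>x. \<bar>\<psi> (exp (- x)) * h x - p (exp (- x)) * h x\<bar> \<le> e / c * \<bar>h x\<bar>"
        using approx[of "e / c"] e c by auto
      have p_int: "integrable lborel (\<lambda>x. p (exp (- x)) * h x)" "(\<integral>x. p (exp (- x)) * h x \<partial>lborel) = 0"
        using poly[OF p(1)] by (simp_all add: has_bochner_integral_iff)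
      have "\<bar>\<integral>x. \<psi> (exp (- x)) * h x \<partial>lborel\<bar> = \<bar>\<integral>x. \<psi> (exp (- x)) * h x - p (exp (- x)) * h x \<partial>lborel\<bar>"
        using int p_int by simp
      also have "\<dots> \<le> (\<integral>x. \<bar>\<psi> (exp (- x)) * h x - p (exp (- x)) * h x\<bar> \<partial>lborel)"
        by (rule integral_abs_bound)
      also have "\<dots> \<le> (\<integral>x. e / c * \<bar>h x\<bar> \<partial>lborel)"
        using int p_int(1) h p(2) by (intro integral_mono) auto
      also have "\<dots> = e / c * (c - 1)" by (simp add: c_def)
      also have "\<dots> \<le> e" using e c by (simp add: field_simps)
      finally show ?thesis by simp
    qed
    then have "\<bar>\<integral>x. \<psi> (exp (- x)) * h x \<partial>lborel\<bar> \<le> 0" by (rule field_le_epsilon)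
    then show "(\<integral>x. \<psi> (exp (- x)) * h x \<partial>lborel) = 0" by simp
  qed
  have pos: "\<phi> y = 0" if y: "0 < y" for y
  proof (rule ccontr)
    assume ne: "\<phi> y \<noteq> 0"
    have "isCont \<phi> y"
      using continuous_on_interior[OF cont, of y] y by simp
    then have "isCont (\<lambda>x. sgn (\<phi> y) * \<phi> x) y" by (intro continuous_intros)
    moreover have "0 < sgn (\<phi> y) * \<phi> y" using ne by (simp add: sgn_if)
    ultimately have "\<forall>\<^sub>F x in nhds y. 0 < sgn (\<phi> y) * \<phi> x"
      by (metis isCont_def order_tendstoD(1) eventually_nhds_conv_at)
    moreover have "\<forall>\<^sub>F x in nhds y. 0 < x" using y by (rule order_tendstoD(1)[OF filterlim_ident])
    ultimately have "\<forall>\<^sub>F x in nhds y. 0 < sgn (\<phi> y) * \<phi> x \<and> 0 < x" by (rule eventually_conj)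
    then obtain e where e: "0 < e" "\<And>x. dist x y < e \<Longrightarrow> 0 < sgn (\<phi> y) * \<phi> x \<and> 0 < x"
      unfolding eventually_nhds_metric by blast
    \<comment> \<open>In the variable \<open>x\<close> this bump is positive exactly on the interval of radius \<open>e\<close> around \<open>y\<close>.\<close>
    define \<psi> where "\<psi> u = max 0 ((u - exp (- (y + e))) * (exp (- (y - e)) - u))" for u
    have cont\<psi>: "continuous_on UNIV \<psi>" unfolding \<psi>_def by (intro continuous_intros)
    let ?F = "\<lambda>x. sgn (\<phi> y) * (\<psi> (exp (- x)) * h x)"
    have \<psi>_in: "0 < \<psi> (exp (- x))" if "dist x y < e" for x
      using that by (auto simp: \<psi>_def dist_real_def abs_less_iff less_max_iff_disj intro!: mult_pos_pos)
    have \<psi>_out: "\<psi> (exp (- x)) = 0" if "\<not> dist x y < e" for x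
    proof (cases "x \<le> y")
      case True
      then have "x \<le> y - e" using that by (simp add: dist_real_def)
      then have "exp (- (y - e)) \<le> exp (- x)" "exp (- (y + e)) \<le> exp (- x)"
        using e(1) by simp_all
      then show ?thesis unfolding \<psi>_def by (intro max_absorb1 mult_nonneg_nonpos) simp_all
    next
      case False
      then have "y + e \<le> x" using that by (simp add: dist_real_def)
      then have "exp (- x) \<le> exp (- (y + e))" "exp (- x) \<le> exp (- (y - e))"
        using e(1) by simp_all
      then show ?thesis unfolding \<psi>_def by (intro max_absorb1 mult_nonpos_nonneg) simp_all
    qed
    have F_pos: "0 < ?F x" if "dist x y < e" for x
    proof -
      have "?F x = \<psi> (exp (- x)) * (exp (- s\<^sub>1 * x) * (sgn (\<phi> y) * \<phi> x))"
        using e(2)[OF that] by (simp add: h_def)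
      also have "0 < \<dots>" using e(2)[OF that] \<psi>_in[OF that] by simp
      finally show ?thesis .
    qed
    have F_int: "integrable lborel ?F" using test_int[OF cont\<psi>] by simp
    have "(\<integral>x. ?F x \<partial>lborel) = 0" using test[OF cont\<psi>] by simp
    moreover have "0 \<le> ?F x" for x
      using F_pos[of x] \<psi>_out[of x] by (cases "dist x y < e") auto
    ultimately have "AE x in lborel. ?F x = 0"
      using integral_nonneg_eq_0_iff_AE[OF F_int] by simp
    then have "AE x in lborel. x \<notin> {y - e <..< y + e}"
    proof eventually_elim
      fix x assume "?F x = 0"
      then have "\<not> dist x y < e" using F_pos[of x] by auto
      then show "x \<notin> {y - e <..< y + e}" by (auto simp: dist_real_def)
    qed
    then have "{y - e <..< y + e} \<in> null_sets lborel"
      by (subst AE_iff_null_sets) auto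
    then have "emeasure lborel {y - e <..< y + e} = 0" by (rule null_setsD1)
    then show False using e(1) by (simp add: emeasure_lborel_Ioo)
  qed
  have "(\<phi> \<longlongrightarrow> \<phi> 0) (at_right 0)"
  proof -
    have "(\<phi> \<longlongrightarrow> \<phi> 0) (at 0 within {0..})" using cont by (simp add: continuous_on_def)
    then show ?thesis by (rule tendsto_within_subset) auto
  qed
  moreover have "(\<phi> \<longlongrightarrow> 0) (at_right 0)"
    by (rule tendsto_eventually) (use eventually_at_right_less[of "0::real"] in \<open>auto elim!: eventually_mono intro: pos\<close>)
  ultimately have "\<phi> 0 = 0"
    by (rule tendsto_unique[rotated]) (simp add: trivial_limit_at_right_real)
  with pos[of x] x show ?thesis by (cases "x = 0") auto
qed

section \<open>The delay equation of the scale function\<close>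

lemma outer_product_mult: "outer_product u v *v w = (v \<bullet> w) *\<^sub>R u"
  by (simp add: vec_eq_iff outer_product_def matrix_vector_mult_def inner_vec_def sum_distrib_left mult_ac)

lemma integral_entry:
  fixes V :: "real \<Rightarrow> real^'n^'m"
  assumes "V integrable_on S"
  shows "integral S V $ i $ j = integral S (\<lambda>x. V x $ i $ j)"
proof -
  have "bounded_linear (\<lambda>A :: real^'n^'m. A $ i $ j)"
    by (rule bounded_linear_compose[OF bounded_linear_vec_nth bounded_linear_vec_nth])
  from integral_linear[OF assms this] show ?thesis by (simp add: o_def)
qed

text \<open>
  This is the equation \<open>\<theta> W' + T W + t \<nu> W(\<cdot> - d) = 0\<close> with \<open>\<theta> W 0 = 1\<close>, read off from the transform by
  uniqueness. It is integrated because \<open>W\<close>, extended by zero to the negative half-line, jumps at \<open>0\<close>, so that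
  \<open>W\<close> need not be differentiable at \<open>d\<close>; the argument \<open>max 0 (y - d)\<close> expresses this extension for the
  primitive \<open>\<Phi>\<close>.
\<close>

lemma scale_function_integral_equation:
  fixes T :: "real^'n^'n"
  assumes W: "scale_function T \<nu> t \<theta> d W" and d: "0 \<le> d" and y: "0 \<le> y"
  defines "\<Phi> \<equiv> \<lambda>y. integral {0..y} W"
  shows "\<theta> *\<^sub>R W y = mat 1 - T ** \<Phi> y - outer_product t \<nu> ** \<Phi> (max 0 (y - d))"
proof -
  have cont: "continuous_on {0..} W" using W by (simp add: scale_function_def)
  have cont_entry: "continuous_on {0..} (\<lambda>x. W x $ i $ j)" for i j
    by (intro continuous_intros cont)
  have integrable: "W integrable_on {0..x}" for x
    by (rule integrable_continuous_real) (rule continuous_on_subset[OF cont], auto)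
  have \<Phi>_entry: "\<Phi> x $ i $ j = integral {0..x} (\<lambda>x. W x $ i $ j)" for x i j
    unfolding \<Phi>_def by (rule integral_entry[OF integrable])
  have cont_\<Phi>: "continuous_on {0..} \<Phi>"
    unfolding continuous_on_def
  proof
    fix x :: real assume x: "x \<in> {0..}"
    have "continuous_on {0..x+1} \<Phi>"
      unfolding \<Phi>_def by (rule indefinite_integral_continuous_1[OF integrable])
    then have "(\<Phi> \<longlongrightarrow> \<Phi> x) (at x within {0..x+1})" using x by (auto simp: continuous_on_def)
    moreover have "at x within {0..x+1} = at x within {0..}"
      by (rule at_within_nhd[of _ "{..<x+1}"]) auto
    ultimately show "(\<Phi> \<longlongrightarrow> \<Phi> x) (at x within {0..})" by simp
  qed
  have cont_\<Phi>_shift: "continuous_on {0..} (\<lambda>x. \<Phi> (max 0 (x - d)))"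
    by (rule continuous_on_compose2[OF cont_\<Phi>]) (auto intro!: continuous_intros)
  obtain s\<^sub>0 where s\<^sub>0: "\<And>s. s\<^sub>0 < s \<Longrightarrow>
      set_integrable lborel {0..} (\<lambda>x. exp (- s * x) *\<^sub>R W x) \<and>
      invertible (T + mat (\<theta> * s) + exp (- d * s) *\<^sub>R outer_product t \<nu>) \<and>
      (LINT x:{0..}|lborel. exp (- s * x) *\<^sub>R W x) = matrix_inv (T + mat (\<theta> * s) + exp (- d * s) *\<^sub>R outer_product t \<nu>)"
    using W unfolding scale_function_def by blast
  define A where "A s = T + mat (\<theta> * s) + exp (- d * s) *\<^sub>R outer_product t \<nu>" for s
  define R where "R s = matrix_inv (A s)" for s
  have W_laplace: "has_laplace (\<lambda>x. W x $ i $ j) s (R s $ i $ j)" if s: "s\<^sub>0 < s" for s i j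
  proof -
    have "has_bochner_integral lborel (\<lambda>x. indicator {0..} x *\<^sub>R (exp (- s * x) *\<^sub>R W x)) (R s)"
      using s\<^sub>0[OF s] unfolding R_def A_def set_integrable_def set_lebesgue_integral_def has_bochner_integral_iff by simp
    from has_bochner_integral_bounded_linear[OF bounded_linear_compose[OF bounded_linear_vec_nth bounded_linear_vec_nth] this, of i j]
    show ?thesis unfolding has_laplace_def by (simp add: mult.assoc)
  qed
  have "\<theta> * W y $ i $ j - mat 1 $ i $ j + ((\<Sum>k\<in>UNIV. T $ i $ k * \<Phi> y $ k $ j) + (\<Sum>k\<in>UNIV. t $ i * \<nu> $ k * \<Phi> (max 0 (y - d)) $ k $ j)) = 0" for i j
  proof (rule laplace_unique[OF _ _ y])
    show "continuous_on {0..} (\<lambda>y. \<theta> * W y $ i $ j - mat 1 $ i $ j + ((\<Sum>k\<in>UNIV. T $ i $ k * \<Phi> y $ k $ j)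
       + (\<Sum>k\<in>UNIV. t $ i * \<nu> $ k * \<Phi> (max 0 (y - d)) $ k $ j)))"
      by (intro continuous_intros cont cont_\<Phi> cont_\<Phi>_shift)
    fix s assume "max s\<^sub>0 0 < s"
    then have s: "s\<^sub>0 < s" "0 < s" by simp_all
    have \<Phi>_laplace: "has_laplace (\<lambda>x. \<Phi> x $ i $ j) s (R s $ i $ j / s)" for i j
      unfolding \<Phi>_entry by (rule has_laplace_integral[OF cont_entry W_laplace[OF s(1)] s(2)])
    have \<Phi>_shift_laplace: "has_laplace (\<lambda>x. \<Phi> (max 0 (x - d)) $ i $ j) s (exp (- s * d) * (R s $ i $ j / s))" for i j
    proof -
      have "(\<lambda>x. \<Phi> (max 0 (x - d)) $ i $ j) = (\<lambda>x. if d \<le> x then \<Phi> (x - d) $ i $ j else 0)"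
        by (auto simp: fun_eq_iff max_def \<Phi>_entry)
      then show ?thesis using has_laplace_shift[OF \<Phi>_laplace d] by simp
    qed
    have "(A s ** R s) $ i $ j = mat 1 $ i $ j"
      using s\<^sub>0[OF s(1)] by (simp add: A_def R_def matrix_inv_inverse)
    also have "(A s ** R s) $ i $ j = (\<Sum>k\<in>UNIV. T $ i $ k * R s $ k $ j) + \<theta> * s * R s $ i $ j + (\<Sum>k\<in>UNIV. t $ i * \<nu> $ k * (exp (- s * d) * R s $ k $ j))"
    proof -
      have "(A s ** R s) $ i $ j = (\<Sum>k\<in>UNIV. T $ i $ k * R s $ k $ j + (if i = k then \<theta> * s * R s $ k $ j else 0) + t $ i * \<nu> $ k * (exp (- s * d) * R s $ k $ j))"
        unfolding matrix_matrix_mult_def vec_lambda_beta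
        by (intro sum.cong refl) (simp add: A_def mat_def outer_product_def algebra_simps)
      then show ?thesis by (simp add: sum.distrib)
    qed
    finally have eq: "(\<Sum>k\<in>UNIV. T $ i $ k * R s $ k $ j) + \<theta> * s * R s $ i $ j + (\<Sum>k\<in>UNIV. t $ i * \<nu> $ k * (exp (- s * d) * R s $ k $ j)) = mat 1 $ i $ j" .
    have "has_laplace (\<lambda>y. \<theta> * W y $ i $ j - mat 1 $ i $ j + ((\<Sum>k\<in>UNIV. T $ i $ k * \<Phi> y $ k $ j)
         + (\<Sum>k\<in>UNIV. t $ i * \<nu> $ k * \<Phi> (max 0 (y - d)) $ k $ j))) s
       (\<theta> * R s $ i $ j - mat 1 $ i $ j / s + ((\<Sum>k\<in>UNIV. T $ i $ k * (R s $ k $ j / s))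
         + (\<Sum>k\<in>UNIV. t $ i * \<nu> $ k * (exp (- s * d) * (R s $ k $ j / s)))))"
      by (intro has_laplace_add has_laplace_diff has_laplace_cmult has_laplace_sum has_laplace_const
          W_laplace \<Phi>_laplace \<Phi>_shift_laplace s)
    also have "\<theta> * R s $ i $ j - mat 1 $ i $ j / s + ((\<Sum>k\<in>UNIV. T $ i $ k * (R s $ k $ j / s))
         + (\<Sum>k\<in>UNIV. t $ i * \<nu> $ k * (exp (- s * d) * (R s $ k $ j / s)))) = 0"
      using s(2) by (simp add: eq[symmetric] sum_divide_distrib[symmetric] field_simps)
    finally show "has_laplace (\<lambda>y. \<theta> * W y $ i $ j - mat 1 $ i $ j + ((\<Sum>k\<in>UNIV. T $ i $ k * \<Phi> y $ k $ j)
         + (\<Sum>k\<in>UNIV. t $ i * \<nu> $ k * \<Phi> (max 0 (y - d)) $ k $ j))) s 0" .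
  qed
  then show ?thesis
    by (auto simp: vec_eq_iff matrix_matrix_mult_def outer_product_def algebra_simps)
qed

lemma integral_from_0_deriv:
  fixes W :: "real \<Rightarrow> 'a::euclidean_space"
  assumes cont: "continuous_on {0..} W" and y: "0 < y"
  shows "((\<lambda>y. integral {0..y} W) has_vector_derivative W y) (at y)"
proof -
  have "((\<lambda>y. integral {0..y} W) has_vector_derivative W y) (at y within {0..y+1})"
    by (rule integral_has_vector_derivative) (use y in \<open>auto intro: continuous_on_subset[OF cont]\<close>)
  moreover have "at y within {0..y+1} = at y"
    by (rule at_within_interior) (use y in simp)
  ultimately show ?thesis by simp
qed

lemma integral_shifted_deriv:
  fixes W :: "real \<Rightarrow> 'a::euclidean_space"
  assumes cont: "continuous_on {0..} W" and y: "0 < y" "y \<noteq> d"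
  shows "((\<lambda>y. integral {0..max 0 (y - d)} W) has_vector_derivative (if d \<le> y then W (y - d) else 0)) (at y)"
proof (cases "d < y")
  case True
  have "((\<lambda>y. integral {0..y - d} W) has_vector_derivative W (y - d)) (at y)"
  proof -
    have "((\<lambda>y. y - d) has_vector_derivative 1) (at y)"
      by (auto intro!: derivative_eq_intros simp flip: has_real_derivative_iff_has_vector_derivative)
    moreover have "((\<lambda>y. integral {0..y} W) has_vector_derivative W (y - d)) (at (y - d))"
      by (rule integral_from_0_deriv[OF cont]) (use True in simp)
    ultimately show ?thesis
      using vector_diff_chain_at[of "\<lambda>y. y - d" 1 y "\<lambda>y. integral {0..y} W" "W (y - d)"]
      by (simp add: o_def)
  qed
  moreover have "open {d<..}" "y \<in> {d<..}" using True by auto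
  ultimately have "((\<lambda>y. integral {0..max 0 (y - d)} W) has_vector_derivative W (y - d)) (at y)"
    by (rule has_vector_derivative_transform_within_open) (auto simp: max_def)
  with True show ?thesis by simp
next
  case False
  have "((\<lambda>y. 0) has_vector_derivative 0) (at y)" by (rule has_vector_derivative_const)
  moreover have "open {..<d}" "y \<in> {..<d}" using False y by auto
  ultimately have "((\<lambda>y. integral {0..max 0 (y - d)} W) has_vector_derivative 0) (at y)"
    by (rule has_vector_derivative_transform_within_open) (auto simp: max_def)
  with False y show ?thesis by simp
qed

lemma continuous_on_integral_from_0:
  fixes W :: "real \<Rightarrow> 'a::euclidean_space"
  assumes cont: "continuous_on {0..} W"
  shows "continuous_on {0..c} (\<lambda>y. integral {0..y} W)"
  by (rule indefinite_integral_continuous_1 integrable_continuous_real continuous_on_subset[OF cont])+ auto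

text \<open>
  Consider the level that climbs at rate \<open>\<theta>\<close> while an observation is in progress and drops by \<open>d\<close> when it ends.
  With \<open>\<kappa> = 1\<close> the equation is satisfied by the expected number of observations still to be completed, as a function
  of level and phase: each completion contributes \<open>1\<close> and restarts the phase from \<open>\<nu>\<close> at the level \<open>y - d\<close>,
  unless this is below zero. With \<open>\<kappa> = 0\<close> it is the homogeneous equation.
\<close>

lemma scale_combination_deriv:
  fixes T :: "real^'n^'n" and K :: "real^'n" and \<kappa> :: real
  assumes W: "scale_function T \<nu> t \<theta> d W" and d: "0 < d" and \<theta>: "0 < \<theta>" and y: "0 < y" "y \<noteq> d"
  defines "g \<equiv> \<lambda>y. W y *v K - \<kappa> *\<^sub>R (integral {0..y} W *v t)"
  shows "(g has_vector_derivative
     - (1 / \<theta>) *\<^sub>R (T *v g y + (\<kappa> + (if d \<le> y then \<nu> \<bullet> g (y - d) else 0)) *\<^sub>R t)) (at y)"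
proof -
  define \<Phi> where "\<Phi> y = integral {0..y} W" for y
  define Wd where "Wd y = (if d \<le> y then W (y - d) else 0)" for y
  note [simp] = bounded_bilinear.scaleR_left[OF bounded_bilinear_matrix_vector_mult]
    bounded_bilinear.scaleR_right[OF bounded_bilinear_matrix_vector_mult]
    bounded_bilinear.diff_left[OF bounded_bilinear_matrix_vector_mult]
    bounded_bilinear.diff_right[OF bounded_bilinear_matrix_vector_mult]
    bounded_bilinear.minus_left[OF bounded_bilinear_matrix_vector_mult]
    bounded_bilinear.add_left[OF bounded_bilinear_matrix_vector_mult]
  have cont: "continuous_on {0..} W" using W by (simp add: scale_function_def)
  have eq: "\<theta> *\<^sub>R W x = mat 1 - T ** \<Phi> x - outer_product t \<nu> ** \<Phi> (max 0 (x - d))" if "0 \<le> x" for x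
    unfolding \<Phi>_def using scale_function_integral_equation[OF W _ that] d by simp
  note mult_deriv = bounded_linear.has_vector_derivative[OF bounded_bilinear.bounded_linear_right[OF bounded_bilinear_matrix_matrix_mult]]
  have \<Phi>_deriv: "(\<Phi> has_vector_derivative W y) (at y)"
    unfolding \<Phi>_def by (rule integral_from_0_deriv[OF cont y(1)])
  have \<Phi>d_deriv: "((\<lambda>y. \<Phi> (max 0 (y - d))) has_vector_derivative Wd y) (at y)"
    unfolding \<Phi>_def Wd_def by (rule integral_shifted_deriv[OF cont y])
  have "((\<lambda>x. (1 / \<theta>) *\<^sub>R (mat 1 - T ** \<Phi> x - outer_product t \<nu> ** \<Phi> (max 0 (x - d)))) has_vector_derivative
      (1 / \<theta>) *\<^sub>R (0 - T ** W y - outer_product t \<nu> ** Wd y)) (at y)"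
    by (intro bounded_linear.has_vector_derivative[OF bounded_linear_scaleR_right]
        has_vector_derivative_diff has_vector_derivative_const mult_deriv \<Phi>_deriv \<Phi>d_deriv)
  moreover have "open {0::real<..}" "y \<in> {0<..}" using y by auto
  ultimately have "(W has_vector_derivative (1 / \<theta>) *\<^sub>R (0 - T ** W y - outer_product t \<nu> ** Wd y)) (at y)"
  proof (rule has_vector_derivative_transform_within_open)
    fix x :: real assume "x \<in> {0<..}"
    then show "(1 / \<theta>) *\<^sub>R (mat 1 - T ** \<Phi> x - outer_product t \<nu> ** \<Phi> (max 0 (x - d))) = W x"
      using \<theta> by (simp flip: eq)
  qed
  then have W_deriv: "(W has_vector_derivative - (1 / \<theta>) *\<^sub>R (T ** W y + outer_product t \<nu> ** Wd y)) (at y)"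
    by (simp add: algebra_simps)
  note vec_deriv = bounded_linear.has_vector_derivative[OF bounded_bilinear.bounded_linear_left[OF bounded_bilinear_matrix_vector_mult]]
  have "(g has_vector_derivative
      (- (1 / \<theta>) *\<^sub>R (T ** W y + outer_product t \<nu> ** Wd y)) *v K - \<kappa> *\<^sub>R (W y *v t)) (at y)"
    unfolding g_def \<Phi>_def[symmetric]
    by (intro has_vector_derivative_diff vec_deriv[OF W_deriv] bounded_linear.has_vector_derivative[OF bounded_linear_scaleR_right] vec_deriv[OF \<Phi>_deriv])
  moreover have "(- (1 / \<theta>) *\<^sub>R (T ** W y + outer_product t \<nu> ** Wd y)) *v K - \<kappa> *\<^sub>R (W y *v t)
     = - (1 / \<theta>) *\<^sub>R (T *v g y + (\<kappa> + (if d \<le> y then \<nu> \<bullet> g (y - d) else 0)) *\<^sub>R t)"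
  proof -
    have Wt: "\<theta> *\<^sub>R (W y *v t) = t - T *v (\<Phi> y *v t) - (\<nu> \<bullet> (\<Phi> (max 0 (y - d)) *v t)) *\<^sub>R t"
      using arg_cong[OF eq, of y "\<lambda>A. A *v t"] y
      by (simp add: matrix_vector_mul_assoc[symmetric] outer_product_mult)
    have gd: "(if d \<le> y then \<nu> \<bullet> g (y - d) else 0) = \<nu> \<bullet> (Wd y *v K) - \<kappa> * (\<nu> \<bullet> (\<Phi> (max 0 (y - d)) *v t))"
      by (auto simp: g_def Wd_def \<Phi>_def max_def inner_diff_right)
    have "\<theta> *\<^sub>R ((- (1 / \<theta>) *\<^sub>R (T ** W y + outer_product t \<nu> ** Wd y)) *v K - \<kappa> *\<^sub>R (W y *v t))
       = - (T *v (W y *v K)) - (\<nu> \<bullet> (Wd y *v K)) *\<^sub>R t - \<kappa> *\<^sub>R (\<theta> *\<^sub>R (W y *v t))"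
      using \<theta> by (simp add: matrix_vector_mul_assoc[symmetric] outer_product_mult algebra_simps)
    also have "\<dots> = - (T *v g y + (\<kappa> + (if d \<le> y then \<nu> \<bullet> g (y - d) else 0)) *\<^sub>R t)"
      unfolding gd Wt by (simp add: g_def \<Phi>_def algebra_simps)
    finally have eqn: "\<theta> *\<^sub>R ((- (1 / \<theta>) *\<^sub>R (T ** W y + outer_product t \<nu> ** Wd y)) *v K - \<kappa> *\<^sub>R (W y *v t)) = \<dots>" .
    show ?thesis
      using \<theta> arg_cong[OF eqn, of "\<lambda>v. (1 / \<theta>) *\<^sub>R v"] by (simp add: algebra_simps)
  qed
  ultimately show ?thesis by simp
qed

lemma scale_combination_continuous:
  fixes W :: "real \<Rightarrow> real^'n^'n"
  assumes cont: "continuous_on {0..} W"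
  shows "continuous_on {0..c} (\<lambda>y. W y *v K - \<kappa> *\<^sub>R (integral {0..y} W *v (t :: real^'n)) :: real^'n)"
  by (intro continuous_intros bounded_linear.continuous_on[OF bounded_bilinear.bounded_linear_left[OF bounded_bilinear_matrix_vector_mult]]
      continuous_on_integral_from_0[OF cont]) (auto intro: continuous_on_subset[OF cont])

text \<open>
  The derivative of \<open>z \<mapsto> exp ((z - y) T / \<theta>) g z\<close> does not involve \<open>T\<close> any more. The point \<open>d\<close> is excluded
  because the delay term jumps there.
\<close>

lemma variation_of_constants:
  fixes T :: "real^'n^'n" and g :: "real \<Rightarrow> real^'n"
  assumes \<theta>: "0 < \<theta>" and yc: "0 \<le> y" "y \<le> c" and cont: "continuous_on {0..c} g"
    and deriv: "\<And>z. 0 < z \<Longrightarrow> z \<noteq> d \<Longrightarrow> (g has_vector_derivative - (1 / \<theta>) *\<^sub>R (T *v g z + r z *\<^sub>R t)) (at z)"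
  shows "((\<lambda>z. (r z / \<theta>) *\<^sub>R (matrix_exp (((z - y) / \<theta>) *\<^sub>R T) *v t)) has_integral
    (g y - matrix_exp (((c - y) / \<theta>) *\<^sub>R T) *v g c)) {y..c}"
proof -
  define E where "E z = matrix_exp (((z - y) / \<theta>) *\<^sub>R T)" for z
  have E_deriv: "(E has_vector_derivative (1 / \<theta>) *\<^sub>R (E z ** T)) (at z)" for z
  proof -
    have "((\<lambda>z. (z - y) / \<theta>) has_vector_derivative 1 / \<theta>) (at z)"
      using \<theta> by (auto intro!: derivative_eq_intros simp flip: has_real_derivative_iff_has_vector_derivative)
    from vector_diff_chain_at[OF this matrix_exp_deriv'] show ?thesis
      by (simp add: o_def E_def[abs_def])
  qed
  have "((\<lambda>z. E z *v g z) has_vector_derivative - ((r z / \<theta>) *\<^sub>R (E z *v t))) (at z)" if "z \<in> {y<..<c} - {d}" for z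
  proof -
    have "((\<lambda>z. E z *v g z) has_vector_derivative
        E z *v (- (1 / \<theta>) *\<^sub>R (T *v g z + r z *\<^sub>R t)) + ((1 / \<theta>) *\<^sub>R (E z ** T)) *v g z) (at z)"
      by (rule bounded_bilinear.has_vector_derivative[OF bounded_bilinear_matrix_vector_mult E_deriv deriv]) (use that yc in auto)
    moreover have "E z *v (- (1 / \<theta>) *\<^sub>R (T *v g z + r z *\<^sub>R t)) + ((1 / \<theta>) *\<^sub>R (E z ** T)) *v g z = - ((r z / \<theta>) *\<^sub>R (E z *v t))"
      by (simp add: bounded_bilinear.scaleR_left[OF bounded_bilinear_matrix_vector_mult]
        bounded_bilinear.scaleR_right[OF bounded_bilinear_matrix_vector_mult]
        bounded_bilinear.minus_right[OF bounded_bilinear_matrix_vector_mult]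
        bounded_bilinear.add_right[OF bounded_bilinear_matrix_vector_mult] matrix_vector_mul_assoc algebra_simps)
    ultimately show ?thesis by simp
  qed
  then have "((\<lambda>z. - ((r z / \<theta>) *\<^sub>R (E z *v t))) has_integral (E c *v g c - E y *v g y)) {y..c}"
    using yc by (intro fundamental_theorem_of_calculus_interior_strong[of "{d}"])
      (auto intro!: bounded_bilinear.continuous_on[OF bounded_bilinear_matrix_vector_mult]
        continuous_intros continuous_on_subset[OF cont] simp: E_def \<theta> divide_inverse)
  from has_integral_neg[OF this] show ?thesis by (simp add: E_def)
qed

section \<open>The renewal equation and non-singularity of the scale function\<close>

lemma phase_type_density_nonneg:
  assumes "phase_type_params T \<nu>"
  shows "0 \<le> phase_type_density T \<nu> x"
proof (cases "0 \<le> x")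
  case True
  have "0 \<le> (matrix_exp (x *\<^sub>R T) *v exit_rates T) $ i" for i
    using matrix_exp_vector_mono[OF phase_type_params_subintensity[OF assms] True, of 0 "exit_rates T" i]
      phase_type_params_subintensity[OF assms] by (simp add: subintensity_def)
  with True assms show ?thesis
    by (auto simp: phase_type_density_def phase_type_params_def inner_vec_def intro!: sum_nonneg mult_nonneg_nonneg)
qed (simp add: phase_type_density_def)

text \<open>
  The density of an observation, started at level \<open>y\<close> and recorded by the level \<open>z\<close> at which it ends, is
  \<open>f ((z - y) / \<theta>) / \<theta>\<close>. Reaching level \<open>c\<close> means that the running observation will be the last one, which is the
  boundary condition \<open>g c = \<kappa> 1\<close>.
\<close>

lemma scale_renewal:
  fixes T :: "real^'n^'n" and K :: "real^'n" and \<kappa> :: real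
  assumes PH: "phase_type_params T \<nu>" and W: "scale_function T \<nu> (exit_rates T) \<theta> d W"
    and d: "0 < d" and \<theta>: "0 < \<theta>" and y: "0 \<le> y" "y \<le> c"
  defines "g \<equiv> \<lambda>y. W y *v K - \<kappa> *\<^sub>R (integral {0..y} W *v exit_rates T)"
  assumes gc: "g c = \<kappa> *\<^sub>R 1"
  shows "((\<lambda>z. (if d \<le> z then \<nu> \<bullet> g (z - d) else 0) * phase_type_density T \<nu> ((z - y) / \<theta>) / \<theta>)
    has_integral (\<nu> \<bullet> g y - \<kappa>)) {y..c}"
proof -
  let ?E = "\<lambda>z. matrix_exp (((z - y) / \<theta>) *\<^sub>R T)"
  define r where "r z = (if d \<le> z then \<nu> \<bullet> g (z - d) else 0)" for z
  have cont: "continuous_on {0..} W" using W by (simp add: scale_function_def)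
  have 1: "((\<lambda>z. ((\<kappa> + r z) / \<theta>) *\<^sub>R (?E z *v exit_rates T)) has_integral (g y - ?E c *v g c)) {y..c}"
  proof (rule variation_of_constants[OF \<theta> y])
    show "continuous_on {0..c} g"
      unfolding g_def by (rule scale_combination_continuous[OF cont])
    show "(g has_vector_derivative - (1 / \<theta>) *\<^sub>R (T *v g z + (\<kappa> + r z) *\<^sub>R exit_rates T)) (at z)"
      if "0 < z" "z \<noteq> d" for z
      using scale_combination_deriv[OF W d \<theta> that, of K \<kappa>] unfolding r_def g_def .
  qed
  \<comment> \<open>The constant \<open>\<kappa>\<close> solves the same equation without feedback, as \<open>T 1 = - exit_rates T\<close>;
      subtracting it cancels both the inhomogeneity and the boundary term.\<close>
  have 2: "((\<lambda>z. (\<kappa> / \<theta>) *\<^sub>R (?E z *v exit_rates T)) has_integral (\<kappa> *\<^sub>R 1 - ?E c *v (\<kappa> *\<^sub>R 1))) {y..c}"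
  proof (rule variation_of_constants[OF \<theta> y])
    show "((\<lambda>z. \<kappa> *\<^sub>R (1 :: real^'n)) has_vector_derivative - (1 / \<theta>) *\<^sub>R (T *v (\<kappa> *\<^sub>R 1) + \<kappa> *\<^sub>R exit_rates T)) (at z)" for z
      by (simp add: exit_rates_def matrix_vector_mult_scaleR)
  qed (intro continuous_intros)
  have "((\<lambda>z. (r z / \<theta>) *\<^sub>R (?E z *v exit_rates T)) has_integral (g y - \<kappa> *\<^sub>R 1)) {y..c}"
    using has_integral_diff[OF 1 2] by (simp add: gc add_divide_distrib algebra_simps)
  from has_integral_linear[OF this bounded_linear_inner_right[of \<nu>]]
  have "((\<lambda>z. r z / \<theta> * (\<nu> \<bullet> (?E z *v exit_rates T))) has_integral (\<nu> \<bullet> (g y - \<kappa> *\<^sub>R 1))) {y..c}"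
    by (simp add: o_def)
  moreover have "\<nu> \<bullet> 1 = 1"
    using PH by (simp add: phase_type_params_def inner_vec_def)
  ultimately have "((\<lambda>z. r z / \<theta> * (\<nu> \<bullet> (?E z *v exit_rates T))) has_integral (\<nu> \<bullet> g y - \<kappa>)) {y..c}"
    by (simp add: inner_diff_right)
  then show ?thesis
    by (rule has_integral_eq[rotated]) (use \<theta> in \<open>auto simp: phase_type_density_def r_def divide_less_0_iff\<close>)
qed

text \<open>
  The survival probability is bounded below on \<open>[0, c / \<theta>]\<close>, so an observation overshoots the level \<open>c\<close> with
  probability at least \<open>\<epsilon>\<close>, whatever the starting level.
\<close>

lemma density_mass_bound:
  fixes T :: "real^'n^'n"
  assumes PH: "phase_type_params T \<nu>" and \<theta>: "0 < \<theta>" and c: "0 < c"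
  obtains I \<epsilon> where "0 < \<epsilon>" "\<And>y. 0 \<le> y \<Longrightarrow> y \<le> c \<Longrightarrow>
    ((\<lambda>z. phase_type_density T \<nu> ((z - y) / \<theta>) / \<theta>) has_integral I y) {y..c} \<and> I y \<le> 1 - \<epsilon>"
proof -
  note T = phase_type_params_subintensity[OF PH]
  obtain q where q: "\<And>x i. 0 \<le> x \<Longrightarrow> exp (- q * x) \<le> (matrix_exp (x *\<^sub>R T) *v 1) $ i"
    using survival_lower_bound[OF T] by blast
  have \<nu>: "\<nu> \<bullet> 1 = 1" "\<And>i. 0 \<le> \<nu> $ i"
    using PH by (simp_all add: phase_type_params_def inner_vec_def)
  let ?S = "\<lambda>y. \<nu> \<bullet> (matrix_exp (((c - y) / \<theta>) *\<^sub>R T) *v 1)"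
  have "((\<lambda>z. phase_type_density T \<nu> ((z - y) / \<theta>) / \<theta>) has_integral (1 - ?S y)) {y..c} \<and> 1 - ?S y \<le> 1 - exp (- \<bar>q\<bar> * (c / \<theta>))"
    if y: "0 \<le> y" "y \<le> c" for y
  proof
    let ?E = "\<lambda>z. matrix_exp (((z - y) / \<theta>) *\<^sub>R T)"
    have "((\<lambda>z. (1 / \<theta>) *\<^sub>R (?E z *v exit_rates T)) has_integral (1 - ?E c *v 1)) {y..c}"
    proof (rule variation_of_constants[OF \<theta> y])
      show "((\<lambda>z. (1 :: real^'n)) has_vector_derivative - (1 / \<theta>) *\<^sub>R (T *v 1 + 1 *\<^sub>R exit_rates T)) (at z)" for z
        by (simp add: exit_rates_def)
    qed (intro continuous_intros)
    from has_integral_linear[OF this bounded_linear_inner_right[of \<nu>]]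
    have "((\<lambda>z. 1 / \<theta> * (\<nu> \<bullet> (?E z *v exit_rates T))) has_integral (1 - ?S y)) {y..c}"
      by (simp add: o_def inner_diff_right \<nu>)
    then show "((\<lambda>z. phase_type_density T \<nu> ((z - y) / \<theta>) / \<theta>) has_integral (1 - ?S y)) {y..c}"
      by (rule has_integral_eq[rotated]) (use \<theta> in \<open>auto simp: phase_type_density_def divide_less_0_iff\<close>)
    have "exp (- \<bar>q\<bar> * (c / \<theta>)) \<le> exp (- q * ((c - y) / \<theta>))"
      using \<theta> y mult_mono[of q "\<bar>q\<bar>" "(c - y) / \<theta>" "c / \<theta>"] by (simp add: divide_right_mono)
    also have "\<dots> = (\<Sum>i\<in>UNIV. \<nu> $ i * exp (- q * ((c - y) / \<theta>)))"
      using \<nu>(1) by (simp add: inner_vec_def sum_distrib_right[symmetric])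
    also have "\<dots> \<le> ?S y"
      unfolding inner_vec_def inner_real_def by (intro sum_mono mult_left_mono q \<nu>) (use y \<theta> in auto)
    finally show "1 - ?S y \<le> 1 - exp (- \<bar>q\<bar> * (c / \<theta>))" by simp
  qed
  then show thesis by (intro that[of "exp (- \<bar>q\<bar> * (c / \<theta>))" "\<lambda>y. 1 - ?S y"]) auto
qed

text \<open>
  A vector \<open>v\<close> in the kernel of \<open>W c\<close> gives a solution \<open>m\<close> of the homogeneous renewal equation, whose kernel is a
  strict contraction by the preceding bound. Hence \<open>m = 0\<close>, then \<open>W 0 v = 0\<close>, and \<open>v = 0\<close> because
  \<open>\<theta> W 0 = 1\<close>.
\<close>

lemma scale_function_invertible:
  fixes T :: "real^'n^'n"
  assumes PH: "phase_type_params T \<nu>" and W: "scale_function T \<nu> (exit_rates T) \<theta> d W"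
    and d: "0 < d" and \<theta>: "0 < \<theta>" and c: "0 < c"
  shows "invertible (W c)"
proof -
  have cont: "continuous_on {0..} W" using W by (simp add: scale_function_def)
  have "v = 0" if v: "W c *v v = 0" for v
  proof -
    define m where "m y = \<nu> \<bullet> (W y *v v)" for y
    define md where "md z = (if d \<le> z then m (z - d) else 0)" for z
    have renewal: "((\<lambda>z. md z * phase_type_density T \<nu> ((z - y) / \<theta>) / \<theta>) has_integral m y) {y..c}"
      if "0 \<le> y" "y \<le> c" for y
      using scale_renewal[OF PH W d \<theta> that, of v 0] v by (simp add: m_def md_def cong: if_cong)
    have cont_g: "continuous_on {0..c} (\<lambda>y. W y *v v)"
      using scale_combination_continuous[OF cont, of c v 0] by simp
    then have "continuous_on {0..c} (\<lambda>y. \<bar>m y\<bar>)"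
      unfolding m_def by (intro continuous_intros)
    then obtain y\<^sub>0 where y\<^sub>0: "y\<^sub>0 \<in> {0..c}" and max: "\<And>y. y \<in> {0..c} \<Longrightarrow> \<bar>m y\<bar> \<le> \<bar>m y\<^sub>0\<bar>"
      using continuous_attains_sup[of "{0..c}" "\<lambda>y. \<bar>m y\<bar>"] c by force
    obtain I \<epsilon> where \<epsilon>: "0 < \<epsilon>" and I: "\<And>y. 0 \<le> y \<Longrightarrow> y \<le> c \<Longrightarrow>
        ((\<lambda>z. phase_type_density T \<nu> ((z - y) / \<theta>) / \<theta>) has_integral I y) {y..c} \<and> I y \<le> 1 - \<epsilon>"
      using density_mass_bound[OF PH \<theta> c] by blast
    have md: "\<bar>md z\<bar> \<le> \<bar>m y\<^sub>0\<bar>" if "z \<in> {y\<^sub>0..c}" for z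
      using max[of "z - d"] that d y\<^sub>0 by (auto simp: md_def)
    let ?f = "\<lambda>z. phase_type_density T \<nu> ((z - y\<^sub>0) / \<theta>) / \<theta>"
    have f: "0 \<le> ?f z" for z using phase_type_density_nonneg[OF PH] \<theta> by simp
    have "norm (integral {y\<^sub>0..c} (\<lambda>z. md z * phase_type_density T \<nu> ((z - y\<^sub>0) / \<theta>) / \<theta>)) \<le> integral {y\<^sub>0..c} (\<lambda>z. \<bar>m y\<^sub>0\<bar> * ?f z)"
    proof (rule integral_norm_bound_integral)
      show "(\<lambda>z. md z * phase_type_density T \<nu> ((z - y\<^sub>0) / \<theta>) / \<theta>) integrable_on {y\<^sub>0..c}"
        using renewal[of y\<^sub>0] y\<^sub>0 by (auto simp: integrable_on_def)
      show "(\<lambda>z. \<bar>m y\<^sub>0\<bar> * ?f z) integrable_on {y\<^sub>0..c}"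
        using I[of y\<^sub>0] y\<^sub>0 by (intro integrable_on_mult_right) (auto intro: has_integral_integrable)
      fix z assume z: "z \<in> {y\<^sub>0..c}"
      have "norm (md z * phase_type_density T \<nu> ((z - y\<^sub>0) / \<theta>) / \<theta>) = \<bar>md z\<bar> * ?f z"
        using \<theta> phase_type_density_nonneg[OF PH] by (simp add: abs_mult)
      also have "\<dots> \<le> \<bar>m y\<^sub>0\<bar> * ?f z"
        by (rule mult_right_mono[OF md[OF z] f])
      finally show "norm (md z * phase_type_density T \<nu> ((z - y\<^sub>0) / \<theta>) / \<theta>) \<le> \<bar>m y\<^sub>0\<bar> * ?f z" .
    qed
    moreover have "integral {y\<^sub>0..c} (\<lambda>z. md z * phase_type_density T \<nu> ((z - y\<^sub>0) / \<theta>) / \<theta>) = m y\<^sub>0"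
      using y\<^sub>0 by (intro integral_unique renewal) auto
    moreover have "integral {y\<^sub>0..c} (\<lambda>z. \<bar>m y\<^sub>0\<bar> * ?f z) = \<bar>m y\<^sub>0\<bar> * I y\<^sub>0"
      using I[of y\<^sub>0] y\<^sub>0 by (intro integral_unique has_integral_mult_right) auto
    ultimately have "\<bar>m y\<^sub>0\<bar> \<le> \<bar>m y\<^sub>0\<bar> * I y\<^sub>0"
      by (simp only: real_norm_def)
    also have "\<dots> \<le> \<bar>m y\<^sub>0\<bar> * (1 - \<epsilon>)"
      using I[of y\<^sub>0] y\<^sub>0 by (intro mult_left_mono) auto
    finally have "\<bar>m y\<^sub>0\<bar> * \<epsilon> \<le> 0" by (simp add: algebra_simps)
    then have "\<bar>m y\<^sub>0\<bar> = 0" using \<epsilon> by (simp add: mult_le_0_iff)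
    then have m_0: "m y = 0" if "y \<in> {0..c}" for y using max[OF that] by simp
    have "((\<lambda>z. (md z / \<theta>) *\<^sub>R (matrix_exp (((z - 0) / \<theta>) *\<^sub>R T) *v exit_rates T)) has_integral
        (W 0 *v v - matrix_exp (((c - 0) / \<theta>) *\<^sub>R T) *v (W c *v v))) {0..c}"
    proof (rule variation_of_constants[OF \<theta> _ _ cont_g])
      show "((\<lambda>y. W y *v v) has_vector_derivative - (1 / \<theta>) *\<^sub>R (T *v (W z *v v) + md z *\<^sub>R exit_rates T)) (at z)"
        if "0 < z" "z \<noteq> d" for z
        using scale_combination_deriv[OF W d \<theta> that, of v 0] by (simp add: md_def m_def cong: if_cong)
    qed (use c in auto)
    moreover have "((\<lambda>z. (md z / \<theta>) *\<^sub>R (matrix_exp (((z - 0) / \<theta>) *\<^sub>R T) *v exit_rates T)) has_integral 0) {0..c}"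
      using m_0 d by (intro has_integral_is_0) (auto simp: md_def)
    ultimately have "W 0 *v v - matrix_exp (((c - 0) / \<theta>) *\<^sub>R T) *v (W c *v v) = 0"
      by (rule has_integral_unique)
    then have "W 0 *v v = 0" by (simp add: v)
    moreover have "\<theta> *\<^sub>R W 0 = mat 1"
      using scale_function_integral_equation[OF W, of 0] d
      by (simp add: bounded_bilinear.zero_right[OF bounded_bilinear_matrix_matrix_mult])
    ultimately show "v = 0"
      by (metis matrix_vector_mul_lid scaleR_matrix_vector_assoc scaleR_zero_right)
  qed
  then show ?thesis
    using matrix_left_invertible_ker[of "W c"] by (simp add: invertible_left_inverse)
qed

section \<open>The expected exit time of a random walk\<close>

lemma (in prob_space) indep_var_integral:
  fixes h :: "'b \<times> 'b \<Rightarrow> real"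
  assumes ind: "indep_var S X R Y" and h[measurable]: "h \<in> borel_measurable (S \<Otimes>\<^sub>M R)" and bound: "\<And>z. \<bar>h z\<bar> \<le> B"
  shows "(\<integral>\<omega>. h (X \<omega>, Y \<omega>) \<partial>M) = (\<integral>\<omega>. (\<integral>\<omega>'. h (X \<omega>, Y \<omega>') \<partial>M) \<partial>M)"
proof -
  have X[measurable]: "random_variable S X" and Y[measurable]: "random_variable R Y"
    using ind by (auto dest: indep_var_rv1 indep_var_rv2)
  have eq: "distr M S X \<Otimes>\<^sub>M distr M R Y = distr M (S \<Otimes>\<^sub>M R) (\<lambda>\<omega>. (X \<omega>, Y \<omega>))"
    using ind by (simp add: indep_var_distribution_eq)
  interpret X: prob_space "distr M S X" by (rule prob_space_distr) fact
  interpret Y: prob_space "distr M R Y" by (rule prob_space_distr) fact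
  interpret XY: pair_prob_space "distr M S X" "distr M R Y" ..
  have int: "integrable (distr M S X \<Otimes>\<^sub>M distr M R Y) h"
    using bound by (intro XY.integrable_const_bound[of _ B]) (auto cong: measurable_cong_sets)
  have "(\<integral>\<omega>. h (X \<omega>, Y \<omega>) \<partial>M) = integral\<^sup>L (distr M S X \<Otimes>\<^sub>M distr M R Y) h"
    unfolding eq by (subst integral_distr) auto
  also have "\<dots> = (\<integral>x. (\<integral>y. h (x, y) \<partial>distr M R Y) \<partial>distr M S X)"
    by (rule XY.integral_fst'[OF int, symmetric])
  also have "\<dots> = (\<integral>x. (\<integral>\<omega>'. h (x, Y \<omega>') \<partial>M) \<partial>distr M S X)"
  proof (rule Bochner_Integration.integral_cong[OF refl])
    fix x assume "x \<in> space (distr M S X)"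
    then have "x \<in> space S" by simp
    then have "(\<lambda>y. h (x, y)) \<in> borel_measurable R" by measurable
    then show "(\<integral>y. h (x, y) \<partial>distr M R Y) = (\<integral>\<omega>'. h (x, Y \<omega>') \<partial>M)"
      by (intro integral_distr Y)
  qed
  also have "\<dots> = (\<integral>\<omega>. (\<integral>\<omega>'. h (X \<omega>, Y \<omega>') \<partial>M) \<partial>M)"
    by (intro integral_distr X) measurable
  finally show ?thesis .
qed

text \<open>
  Put \<open>e k = E[m(L k); L 0, \<dots>, L k \<in> J]\<close>. Conditioning on the first \<open>k\<close> steps, the renewal equation gives
  \<open>e k - e (k + 1) = P(L 0, \<dots>, L k \<in> J)\<close>, so the probabilities telescope. Boundedness of \<open>m\<close> makes the series
  converge, which forces \<open>e k \<rightarrow> 0\<close> and at the same time shows that the walk leaves \<open>J\<close>.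
\<close>

lemma (in prob_space) random_walk_exit_time:
  fixes \<zeta> :: "nat \<Rightarrow> 'a \<Rightarrow> real" and m s :: "real \<Rightarrow> real"
  assumes ind: "indep_vars (\<lambda>_. borel) \<zeta> {1..}"
    and m[measurable]: "m \<in> borel_measurable borel" and bound: "\<And>y. \<bar>m y\<bar> \<le> B"
    and s[measurable]: "s \<in> borel_measurable borel" and J[measurable]: "J \<in> sets borel"
    and outside: "\<And>y. y \<notin> J \<Longrightarrow> m y = 0"
    and renewal: "\<And>k y. y \<in> J \<Longrightarrow> m y = 1 + (\<integral>\<omega>. m (y + s (\<zeta> (Suc k) \<omega>)) \<partial>M)"
    and x: "x \<in> J"
  defines "L \<equiv> \<lambda>k \<omega>. x + (\<Sum>j=1..k. s (\<zeta> j \<omega>))"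
  shows "(\<lambda>k. prob {\<omega>\<in>space M. \<forall>j\<le>k. L j \<omega> \<in> J}) sums m x"
proof -
  have \<zeta>[measurable]: "random_variable borel (\<zeta> j)" if "1 \<le> j" for j
    using ind that by (auto simp: indep_vars_def)
  have L[measurable]: "random_variable borel (L k)" for k
    unfolding L_def by (intro borel_measurable_add borel_measurable_const borel_measurable_sum measurable_compose[OF \<zeta> s]) auto
  define A where "A k = {\<omega>\<in>space M. \<forall>j\<le>k. L j \<omega> \<in> J}" for k
  have A[measurable]: "A k \<in> events" for k
    unfolding A_def by measurable
  define e where "e k = (\<integral>\<omega>. indicator (A k) \<omega> * m (L k \<omega>) \<partial>M)" for k
  have B: "0 \<le> B" using bound[of 0] by linarith
  have int: "integrable M (\<lambda>\<omega>. indicator (A k) \<omega> * m (L k \<omega>))" for k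
    using bound B by (intro integrable_const_bound[of _ B]) (auto split: split_indicator)
  have int_A: "integrable M (indicator (A k) :: 'a \<Rightarrow> real)" for k
    by (rule integrable_real_indicator) (simp_all add: less_top[symmetric])
  have step: "e (Suc k) = e k - prob (A k)" for k
  proof -
    define H where "H v = (indicator {v. \<forall>j\<le>k. x + (\<Sum>i=1..j. s (v i)) \<in> J} v :: real)" for v
    define V where "V v = x + (\<Sum>i=1..k. s (v i))" for v :: "nat \<Rightarrow> real"
    let ?P = "Pi\<^sub>M {1..k} (\<lambda>_. borel :: real measure)"
    define X where "X \<omega> = restrict (\<lambda>i. \<zeta> i \<omega>) {1..k}" for \<omega>
    have sums[measurable]: "(\<lambda>v. x + (\<Sum>i=1..j. s (v i))) \<in> borel_measurable ?P" if "j \<le> k" for j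
      using that by (intro borel_measurable_add borel_measurable_const borel_measurable_sum
        measurable_compose[OF _ s] measurable_component_singleton) auto
    have V[measurable]: "V \<in> borel_measurable ?P"
      unfolding V_def by (rule sums) simp
    have H[measurable]: "H \<in> borel_measurable ?P"
    proof -
      have "(\<lambda>v. if \<forall>j\<in>{..k}. x + (\<Sum>i=1..j. s (v i)) \<in> J then 1 else 0 :: real) \<in> borel_measurable ?P"
        by measurable
      then show ?thesis by (simp add: H_def[abs_def] indicator_def cong: if_cong)
    qed
    have sum_X: "(\<Sum>i=1..j. s (X \<omega> i)) = (\<Sum>i=1..j. s (\<zeta> i \<omega>))" if "j \<le> k" for j \<omega>
      using that by (intro sum.cong) (auto simp: X_def)
    have HX: "H (X \<omega>) = indicator (A k) \<omega>" if "\<omega> \<in> space M" for \<omega>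
      using that by (auto simp: H_def A_def L_def sum_X indicator_def simp del: One_nat_def)
    have VX: "V (X \<omega>) = L k \<omega>" for \<omega>
      by (simp add: V_def L_def sum_X del: One_nat_def)
    let ?P' = "Pi\<^sub>M {Suc k} (\<lambda>_. borel :: real measure)"
    define Y where "Y \<omega> = restrict (\<lambda>i. \<zeta> i \<omega>) {Suc k}" for \<omega>
    have Y: "Y \<omega> (Suc k) = \<zeta> (Suc k) \<omega>" for \<omega> by (simp add: Y_def)
    have indXY: "indep_var ?P X ?P' Y"
      unfolding X_def[abs_def] Y_def[abs_def] by (rule indep_var_restrict[OF ind]) auto
    define h where "h = (\<lambda>(v, w). H v * m (V v + s (w (Suc k))))"
    have h[measurable]: "h \<in> borel_measurable (?P \<Otimes>\<^sub>M ?P')"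
      unfolding h_def by measurable
    have h_bound: "\<bar>h z\<bar> \<le> B" for z
      using bound B by (auto simp: h_def H_def split: prod.split split_indicator)
    have "e (Suc k) = (\<integral>\<omega>. h (X \<omega>, Y \<omega>) \<partial>M)"
      unfolding e_def
    proof (rule Bochner_Integration.integral_cong[OF refl])
      fix \<omega> assume \<omega>: "\<omega> \<in> space M"
      have L_Suc: "L (Suc k) \<omega> = L k \<omega> + s (\<zeta> (Suc k) \<omega>)" by (simp add: L_def)
      have A_Suc: "\<omega> \<in> A (Suc k) \<longleftrightarrow> \<omega> \<in> A k \<and> L (Suc k) \<omega> \<in> J"
        by (auto simp: A_def le_Suc_eq)
      show "indicator (A (Suc k)) \<omega> * m (L (Suc k) \<omega>) = h (X \<omega>, Y \<omega>)"
        using outside[of "L (Suc k) \<omega>"] A_Suc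
        by (auto simp: h_def HX[OF \<omega>] VX Y L_Suc split: split_indicator)
    qed
    also have "\<dots> = (\<integral>\<omega>. (\<integral>\<omega>'. h (X \<omega>, Y \<omega>') \<partial>M) \<partial>M)"
      by (rule indep_var_integral[OF indXY h h_bound])
    also have "\<dots> = (\<integral>\<omega>. indicator (A k) \<omega> * m (L k \<omega>) - indicator (A k) \<omega> \<partial>M)"
    proof (rule Bochner_Integration.integral_cong[OF refl])
      fix \<omega> assume \<omega>: "\<omega> \<in> space M"
      show "(\<integral>\<omega>'. h (X \<omega>, Y \<omega>') \<partial>M) = indicator (A k) \<omega> * m (L k \<omega>) - indicator (A k) \<omega>"
      proof (cases "\<omega> \<in> A k")
        case True
        then have "L k \<omega> \<in> J" by (auto simp: A_def)
        from renewal[OF this, of k] True show ?thesis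
          by (simp add: h_def HX[OF \<omega>] VX Y)
      qed (simp add: h_def HX[OF \<omega>])
    qed
    also have "\<dots> = e k - prob (A k)"
      unfolding e_def using int int_A
      by (subst Bochner_Integration.integral_diff) (simp_all add: Int_absorb2 sets.sets_into_space)
    finally show ?thesis .
  qed
  have e0: "e 0 = m x"
    using x by (simp add: e_def A_def L_def prob_space)
  have partial: "(\<Sum>k<n. prob (A k)) = m x - e n" for n
    by (induction n) (simp_all add: e0 step)
  have e_bound: "\<bar>e n\<bar> \<le> B * prob (A n)" for n
  proof -
    have "\<bar>e n\<bar> \<le> (\<integral>\<omega>. \<bar>indicator (A n) \<omega> * m (L n \<omega>)\<bar> \<partial>M)"
      unfolding e_def by (rule integral_abs_bound)
    also have "\<dots> \<le> (\<integral>\<omega>. B * indicator (A n) \<omega> \<partial>M)"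
      using int int_A bound B by (intro integral_mono) (auto split: split_indicator)
    also have "\<dots> = B * prob (A n)" by (simp add: Int_absorb2 sets.sets_into_space)
    finally show ?thesis .
  qed
  have "summable (\<lambda>k. prob (A k))"
  proof (rule summableI_nonneg_bounded)
    fix n
    have "\<bar>e n\<bar> \<le> B * 1"
      using e_bound[of n] mult_left_mono[OF prob_le_1 B, of "A n"] by simp
    then show "(\<Sum>k<n. prob (A k)) \<le> m x + B" by (simp add: partial)
  qed simp
  then have "(\<lambda>n. prob (A n)) \<longlonglongrightarrow> 0" by (rule summable_LIMSEQ_zero)
  then have "(\<lambda>n. B * prob (A n)) \<longlonglongrightarrow> 0" by (rule tendsto_mult_right_zero)
  then have "e \<longlonglongrightarrow> 0"
    by (rule Lim_null_comparison[rotated]) (use e_bound in auto)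
  from tendsto_diff[OF tendsto_const[of "m x"] this]
  show ?thesis unfolding sums_def A_def[symmetric] partial by simp
qed

lemma Inf_enat_image:
  "Inf (enat ` {k. Q k}) = (if \<exists>k. Q k then enat (LEAST k. Q k) else \<infinity>)"
proof (cases "\<exists>k. Q k")
  case True
  then have "Q (LEAST k. Q k)" by (metis LeastI_ex)
  then have "Inf (enat ` {k. Q k}) = enat (LEAST k. Q k)"
    by (intro antisym Inf_lower Inf_greatest) (auto intro: Least_le)
  with True show ?thesis by simp
qed (simp add: top_enat_def)

lemma (in prob_space) expected_first_exit:
  assumes [measurable]: "\<And>k. Measurable.pred M (Q k)"
    and sums: "(\<lambda>k. prob {\<omega>\<in>space M. \<forall>j\<le>k. \<not> Q j \<omega>}) sums r"
  shows "(\<integral>\<^sup>+\<omega>. ennreal_of_enat (Inf (enat ` {k. Q k \<omega>})) \<partial>M) = ennreal r"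
proof -
  let ?N = "\<lambda>\<omega>. Inf (enat ` {k. Q k \<omega>})"
  have [measurable]: "?N \<in> measurable M (count_space UNIV)"
    unfolding Inf_enat_image by measurable
  have less: "enat k < ?N \<omega> \<longleftrightarrow> (\<forall>j\<le>k. \<not> Q j \<omega>)" for k \<omega>
  proof (cases "\<exists>k. Q k \<omega>")
    case True
    then have "Q (LEAST k. Q k \<omega>) \<omega>" by (rule LeastI_ex)
    then have "k < (LEAST k. Q k \<omega>) \<longleftrightarrow> (\<forall>j\<le>k. \<not> Q j \<omega>)"
      by (meson le_less_trans not_less_Least not_le)
    with True show ?thesis by (simp add: Inf_enat_image)
  qed (simp add: top_enat_def)
  have "(\<integral>\<^sup>+\<omega>. ennreal_of_enat (?N \<omega>) \<partial>M) = (\<Sum>k. ennreal (prob {\<omega>\<in>space M. \<forall>j\<le>k. \<not> Q j \<omega>}))"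
    by (subst nn_integral_enat_function) (simp_all add: less emeasure_eq_measure)
  also have "\<dots> = ennreal r"
    using sums by (intro suminf_ennreal_eq) auto
  finally show ?thesis .
qed

section \<open>The number of observations in the test\<close>

lemma phase_type_density_measurable [measurable]: "phase_type_density T \<nu> \<in> borel_measurable borel"
proof -
  have [measurable]: "(\<lambda>x. \<nu> \<bullet> (matrix_exp (x *\<^sub>R T) *v exit_rates T)) \<in> borel_measurable borel"
    by (rule borel_measurable_continuous_onI)
      (intro continuous_intros bounded_linear.continuous_on[OF bounded_bilinear.bounded_linear_left[OF bounded_bilinear_matrix_vector_mult]])
  show ?thesis
    unfolding phase_type_density_def[abs_def] by measurable
qed

text \<open>
  The set \<open>S\<close> absorbs the levels at which two conventions for the boundary of the interval disagree: the delay
  equation switches on at level \<open>0\<close> inclusively, whereas the test stops there.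
\<close>

lemma renewal_substitution:
  fixes f m :: "real \<Rightarrow> real"
  assumes f: "integrable lborel f" "\<And>u. u < 0 \<Longrightarrow> f u = 0"
    and m: "m \<in> borel_measurable borel" "\<And>z. \<bar>m z\<bar> \<le> B" "\<And>z. c - d \<le> z \<Longrightarrow> m z = 0"
    and eq: "\<And>z. z \<in> {y..c} - S \<Longrightarrow> h z = m (z - d)" and S: "finite S" and \<theta>: "0 < \<theta>"
    and I: "((\<lambda>z. h z * f ((z - y) / \<theta>) / \<theta>) has_integral I) {y..c}"
  shows "(\<integral>u. f u * m (y + (\<theta> * u - d)) \<partial>lborel) = I"
proof -
  note [measurable] = m(1) borel_measurable_integrable[OF f(1), simplified]
  define F where "F u = f u * m (y + (\<theta> * u - d))" for u
  have F: "integrable lborel F"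
  proof (rule Bochner_Integration.integrable_bound)
    show "integrable lborel (\<lambda>u. B * f u)" using f(1) by simp
    show "AE u in lborel. norm (F u) \<le> norm (B * f u)"
      using m(2) order_trans[OF abs_ge_zero m(2)]
      by (auto simp: F_def abs_mult mult.commute[of B] intro!: mult_left_mono)
    show "F \<in> borel_measurable lborel" unfolding F_def by measurable
  qed
  have "has_bochner_integral lborel (\<lambda>z. F (- y / \<theta> + (1 / \<theta>) * z)) (integral\<^sup>L lborel F /\<^sub>R \<bar>1 / \<theta>\<bar>)"
    using \<theta> F by (subst lborel_has_bochner_integral_real_affine_iff[symmetric]) (auto simp: has_bochner_integral_iff)
  from has_bochner_integral_mult_right[OF this, of "1 / \<theta>"]
  have "has_bochner_integral lborel (\<lambda>z. F ((z - y) / \<theta>) / \<theta>) (integral\<^sup>L lborel F)"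
    using \<theta> by (simp add: diff_divide_distrib add.commute)
  then have "integrable lborel (\<lambda>z. F ((z - y) / \<theta>) / \<theta>)"
    and "(\<integral>z. F ((z - y) / \<theta>) / \<theta> \<partial>lborel) = integral\<^sup>L lborel F"
    by (simp_all only: has_bochner_integral_iff)
  then have "((\<lambda>z. F ((z - y) / \<theta>) / \<theta>) has_integral integral\<^sup>L lborel F) UNIV"
    by (metis has_integral_integral_lborel)
  moreover have "F ((z - y) / \<theta>) = f ((z - y) / \<theta>) * m (z - d)" for z
    using \<theta> by (simp add: F_def)
  ultimately have "((\<lambda>z. m (z - d) * f ((z - y) / \<theta>) / \<theta>) has_integral integral\<^sup>L lborel F) UNIV"
    by (simp add: mult.commute)
  moreover have "(if z \<in> {y..c} then m (z - d) * f ((z - y) / \<theta>) / \<theta> else 0) = m (z - d) * f ((z - y) / \<theta>) / \<theta>" for z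
    using f(2)[of "(z - y) / \<theta>"] m(3)[of "z - d"] \<theta> by (auto simp: divide_less_0_iff)
  ultimately have "((\<lambda>z. m (z - d) * f ((z - y) / \<theta>) / \<theta>) has_integral integral\<^sup>L lborel F) {y..c}"
    by (subst has_integral_restrict_UNIV[symmetric]) (simp only:)
  moreover have "((\<lambda>z. m (z - d) * f ((z - y) / \<theta>) / \<theta>) has_integral I) {y..c}"
    by (rule has_integral_spike_finite[OF S _ I]) (use eq in auto)
  ultimately show ?thesis unfolding F_def by (rule has_integral_unique)
qed

lemma expected_exit_time:
  fixes T :: "real^'n^'n" and \<zeta> :: "nat \<Rightarrow> 'w \<Rightarrow> real"
  assumes PH: "phase_type_params T \<nu>" and W: "scale_function T \<nu> (exit_rates T) \<theta> d W"
    and d: "0 < d" and \<theta>: "0 < \<theta>" and ab: "a < 0" "0 < b"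
    and iid: "iid_with_density P \<zeta> (phase_type_density T \<nu>)"
  shows "(\<integral>\<^sup>+\<omega>. ennreal_of_enat (Inf (enat ` {k. (\<Sum>j=1..k. \<theta> * \<zeta> j \<omega> - d) \<notin> {a<..<b}})) \<partial>P) = ennreal (
          - integral {0..- a} (\<lambda>y. \<nu> \<bullet> (W y *v exit_rates T))
          + \<nu> \<bullet> ((W (- a) ** matrix_inv (W (- a + b + d))) *v
              (integral {0..- a + b + d} (\<lambda>y. W y *v exit_rates T) + 1)))"
    (is "?EN = ennreal ?r")
proof -
  interpret prob_space P using iid by (simp add: iid_with_density_def)
  have ind: "indep_vars (\<lambda>_. borel) \<zeta> {1..}" and dist: "\<And>j. 1 \<le> j \<Longrightarrow> distributed P lborel (\<zeta> j) (\<lambda>x. ennreal (phase_type_density T \<nu> x))"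
    using iid by (auto simp: iid_with_density_def)
  let ?f = "phase_type_density T \<nu>"
  have [measurable]: "random_variable borel (\<zeta> j)" if "1 \<le> j" for j
    using ind that by (auto simp: indep_vars_def)
  have f_int: "integrable lborel ?f"
  proof (rule integrableI_nn_integral_finite[where x = 1])
    have eq: "distr P lborel (\<zeta> 1) = density lborel ?f"
      using dist[of 1] by (simp add: distributed_def)
    have "prob_space (distr P lborel (\<zeta> 1))"
      using dist[of 1] by (intro prob_space_distr) (simp add: distributed_def)
    from prob_space.emeasure_space_1[OF this] have "emeasure (density lborel ?f) UNIV = 1"
      unfolding eq by simp
    then show "(\<integral>\<^sup>+x. ennreal (?f x) \<partial>lborel) = ennreal 1"
      by (simp add: emeasure_density)
  qed (auto simp: phase_type_density_nonneg[OF PH])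
  have cont: "continuous_on {0..} W" using W by (simp add: scale_function_def)
  have integrable: "W integrable_on {0..x}" for x
    by (rule integrable_continuous_real) (rule continuous_on_subset[OF cont], auto)
  have W_int: "integral {0..x} W *v exit_rates T = integral {0..x} (\<lambda>y. W y *v exit_rates T)"
    and W_integrable: "(\<lambda>y. W y *v exit_rates T) integrable_on {0..x}" for x
    using integral_linear[OF integrable bounded_bilinear.bounded_linear_left[OF bounded_bilinear_matrix_vector_mult]]
      integrable_linear[OF integrable bounded_bilinear.bounded_linear_left[OF bounded_bilinear_matrix_vector_mult]]
    by (auto simp: o_def)
  \<comment> \<open>Levels are measured from \<open>a\<close>. The level just before a drop by \<open>d\<close> to the upper boundary is \<open>c\<close>.\<close>
  define c where "c = - a + b + d"
  have c: "0 < c" "d < c" "c - d = b - a" using ab d by (auto simp: c_def)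
  \<comment> \<open>This choice of \<open>K\<close> is forced by the boundary value \<open>1\<close> at level \<open>c\<close>.\<close>
  define K where "K = matrix_inv (W c) *v (integral {0..c} W *v exit_rates T + 1)"
  define g where "g y = W y *v K - 1 *\<^sub>R (integral {0..y} W *v exit_rates T)" for y
  define m where "m y = (if y \<in> {0<..<b - a} then \<nu> \<bullet> g y else 0)" for y
  have gc: "g c = 1 *\<^sub>R 1"
    unfolding g_def K_def
    by (simp add: matrix_inv_mult[OF scale_function_invertible[OF PH W d \<theta> c(1)]])
  have cont_g: "continuous_on {0..c} (\<lambda>y. \<nu> \<bullet> g y)"
    unfolding g_def[abs_def] by (intro continuous_intros scale_combination_continuous[OF cont])
  obtain B where B: "\<And>y. \<bar>m y\<bar> \<le> B"
  proof -
    have "bounded ((\<lambda>y. \<nu> \<bullet> g y) ` {0..c})"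
      by (intro compact_imp_bounded compact_continuous_image cont_g) simp
    then obtain B where B: "\<And>y. y \<in> {0..c} \<Longrightarrow> \<bar>\<nu> \<bullet> g y\<bar> \<le> B"
      unfolding bounded_iff ball_simps real_norm_def by blast
    from B[of 0] have "0 \<le> B" using c(1) by (simp add: order_trans[OF abs_ge_zero])
    with B have "\<bar>m y\<bar> \<le> B" for y using c d by (auto simp: m_def)
    then show thesis by (rule that)
  qed
  have m_meas[measurable]: "m \<in> borel_measurable borel"
  proof -
    have "continuous_on {0<..<b - a} (\<lambda>y. \<nu> \<bullet> g y)"
      by (rule continuous_on_subset[OF cont_g]) (use c d in auto)
    from borel_measurable_continuous_on_indicator[OF _ this]
    have "(\<lambda>y. indicator {0<..<b - a} y *\<^sub>R (\<nu> \<bullet> g y)) \<in> borel_measurable borel" by simp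
    also have "(\<lambda>y. indicator {0<..<b - a} y *\<^sub>R (\<nu> \<bullet> g y)) = m"
      by (auto simp: m_def fun_eq_iff)
    finally show ?thesis .
  qed
  have renewal: "m y = 1 + (\<integral>\<omega>. m (y + (\<theta> * \<zeta> (Suc k) \<omega> - d)) \<partial>P)" if y: "y \<in> {0<..<b - a}" for k y
  proof -
    have "((\<lambda>z. (if d \<le> z then \<nu> \<bullet> g (z - d) else 0) * ?f ((z - y) / \<theta>) / \<theta>) has_integral (\<nu> \<bullet> g y - 1)) {y..c}"
      unfolding g_def by (rule scale_renewal[OF PH W d \<theta>]) (use y c d gc in \<open>auto simp: g_def\<close>)
    then have "(\<integral>u. ?f u * m (y + (\<theta> * u - d)) \<partial>lborel) = \<nu> \<bullet> g y - 1"
    proof (rule renewal_substitution[OF f_int _ m_meas B, where S = "{d, c}", rotated -1])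
      show "z \<in> {y..c} - {d, c} \<Longrightarrow> (if d \<le> z then \<nu> \<bullet> g (z - d) else 0) = m (z - d)" for z
        using c by (auto simp: m_def)
      show "c - d \<le> z \<Longrightarrow> m z = 0" for z using c by (auto simp: m_def)
    qed (use \<theta> in \<open>auto simp: phase_type_density_def\<close>)
    also have "(\<integral>u. ?f u * m (y + (\<theta> * u - d)) \<partial>lborel) = (\<integral>\<omega>. m (y + (\<theta> * \<zeta> (Suc k) \<omega> - d)) \<partial>P)"
      using dist[of "Suc k"] by (intro distributed_integral) (auto simp: phase_type_density_nonneg[OF PH])
    finally show ?thesis using y by (simp add: m_def)
  qed
  have iff: "- a + z \<in> {0<..<b - a} \<longleftrightarrow> z \<in> {a<..<b}" for z by auto
  have "(\<lambda>k. prob {\<omega>\<in>space P. \<forall>j\<le>k. - a + (\<Sum>i=1..j. \<theta> * \<zeta> i \<omega> - d) \<in> {0<..<b - a}}) sums m (- a)"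
    by (rule random_walk_exit_time[OF ind m_meas B, where s = "\<lambda>u. \<theta> * u - d"])
      (use renewal ab in \<open>auto simp: m_def\<close>)
  then have "(\<lambda>k. prob {\<omega>\<in>space P. \<forall>j\<le>k. \<not> (\<Sum>i=1..j. \<theta> * \<zeta> i \<omega> - d) \<notin> {a<..<b}}) sums m (- a)"
    by (simp only: iff not_not)
  then have "?EN = ennreal (m (- a))"
  proof (rule expected_first_exit[rotated])
    fix k
    have [measurable]: "(\<lambda>\<omega>. \<Sum>j=1..k. \<theta> * \<zeta> j \<omega> - d) \<in> borel_measurable P"
      by (intro borel_measurable_sum borel_measurable_diff borel_measurable_times borel_measurable_const) auto
    show "Measurable.pred P (\<lambda>\<omega>. (\<Sum>j=1..k. \<theta> * \<zeta> j \<omega> - d) \<notin> {a<..<b})"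
      by measurable
  qed
  also have "m (- a) = ?r"
  proof -
    have "integral {0..- a} (\<lambda>y. \<nu> \<bullet> (W y *v exit_rates T)) = \<nu> \<bullet> integral {0..- a} (\<lambda>y. W y *v exit_rates T)"
      using integral_linear[OF W_integrable bounded_linear_inner_right[of \<nu>], of "- a"] by (simp add: o_def)
    then show ?thesis
      using ab by (simp add: m_def g_def K_def c_def W_int inner_diff_right matrix_vector_mul_assoc)
  qed
  finally show ?thesis .
qed

text \<open>
  Almost surely no observation falls where its density vanishes, and elsewhere the ratio of the two densities is
  \<open>G exp (\<theta> x)\<close>.
\<close>

lemma log_likelihood_ratio_tilted:
  assumes iid: "iid_with_density P \<zeta> f" and pos: "\<And>x. 0 < f x \<Longrightarrow> 0 < f\<^sub>0 x"
    and G: "0 < G" and d: "d = - ln G"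
  shows "AE \<omega> in P. \<forall>k. log_likelihood_ratio f\<^sub>0 (\<lambda>x. 1 / G * exp (- \<theta> * x) * f\<^sub>0 x) \<zeta> k \<omega> = (\<Sum>j=1..k. \<theta> * \<zeta> j \<omega> - d)"
proof -
  interpret prob_space P using iid by (simp add: iid_with_density_def)
  have dist: "distributed P lborel (\<zeta> j) (\<lambda>x. ennreal (f x))" if "1 \<le> j" for j
    using iid that by (simp add: iid_with_density_def)
  have "AE \<omega> in P. 0 < f (\<zeta> j \<omega>)" if j: "1 \<le> j" for j
  proof -
    have [measurable]: "(\<lambda>x. ennreal (f x)) \<in> borel_measurable lborel" "\<zeta> j \<in> measurable P lborel"
      and eq: "distr P lborel (\<zeta> j) = density lborel (\<lambda>x. ennreal (f x))"
      using dist[OF j] by (simp_all add: distributed_def)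
    have "AE x in density lborel (\<lambda>x. ennreal (f x)). 0 < ennreal (f x)"
      by (subst AE_density) auto
    then have "AE x in distr P lborel (\<zeta> j). 0 < ennreal (f x)" by (simp only: eq)
    then have "AE \<omega> in P. 0 < ennreal (f (\<zeta> j \<omega>))" by (rule AE_distrD[rotated]) measurable
    then show ?thesis by (rule eventually_mono) simp
  qed
  then have "AE \<omega> in P. \<forall>j\<in>{1..}. 0 < f (\<zeta> j \<omega>)"
    by (subst AE_ball_countable) auto
  then show ?thesis
  proof eventually_elim
    fix \<omega> assume \<omega>: "\<forall>j\<in>{1..}. 0 < f (\<zeta> j \<omega>)"
    have "ln (f\<^sub>0 (\<zeta> j \<omega>) / (1 / G * exp (- \<theta> * \<zeta> j \<omega>) * f\<^sub>0 (\<zeta> j \<omega>))) = \<theta> * \<zeta> j \<omega> - d" if "1 \<le> j" for j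
    proof -
      have f0: "0 < f\<^sub>0 (\<zeta> j \<omega>)" using \<omega> that pos by auto
      then have "f\<^sub>0 (\<zeta> j \<omega>) / (1 / G * exp (- \<theta> * \<zeta> j \<omega>) * f\<^sub>0 (\<zeta> j \<omega>)) = G * exp (\<theta> * \<zeta> j \<omega>)"
        using G by (simp add: exp_minus field_simps)
      then show ?thesis using G by (simp add: ln_mult d)
    qed
    then show "\<forall>k. log_likelihood_ratio f\<^sub>0 (\<lambda>x. 1 / G * exp (- \<theta> * x) * f\<^sub>0 x) \<zeta> k \<omega> = (\<Sum>j=1..k. \<theta> * \<zeta> j \<omega> - d)"
      by (auto simp: log_likelihood_ratio_def intro!: sum.cong)
  qed
qed

theorem mainTheorem4:
  fixes T :: "nat \<Rightarrow> real^'n^'n" and \<nu> t :: "nat \<Rightarrow> real^'n"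
    and f :: "nat \<Rightarrow> real \<Rightarrow> real"
    and \<theta> G\<^sub>0 d a b :: real and \<Delta> :: "real^'n^'n"
    and P :: "nat \<Rightarrow> 'w measure" and \<zeta> :: "nat \<Rightarrow> 'w \<Rightarrow> real"
    and N :: "'w \<Rightarrow> enat"
    and W :: "nat \<Rightarrow> real \<Rightarrow> real^'n^'n"
  assumes PH0: "phase_type_params (T 0) (\<nu> 0)"
    and t0: "t 0 = exit_rates (T 0)"
    and f0: "f 0 = phase_type_density (T 0) (\<nu> 0)"
    and \<theta>: "\<theta> > 0"
    and G0: "G\<^sub>0 = \<nu> 0 \<bullet> (matrix_inv (mat \<theta> - T 0) *v t 0)"
    and d: "d = - ln G\<^sub>0"
    and f1: "f 1 = (\<lambda>x. 1 / G\<^sub>0 * exp (- \<theta> * x) * f 0 x)"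
    and \<Delta>: "\<Delta> = diag_matrix (matrix_inv (mat \<theta> - T 0) *v t 0)"
    and T1: "T 1 = matrix_inv \<Delta> ** T 0 ** \<Delta> - mat \<theta>"
    and \<nu>1: "\<nu> 1 = (1 / G\<^sub>0) *\<^sub>R (\<nu> 0 v* \<Delta>)"
    and t1: "t 1 = matrix_inv \<Delta> *v t 0"
    and a: "a < 0" and b: "0 < b"
    and N: "N = num_observations (f 0) (f 1) a b \<zeta>"
  shows "d > 0 \<and>
    phase_type_params (T 1) (\<nu> 1) \<and> t 1 = exit_rates (T 1) \<and>
    f 1 = phase_type_density (T 1) (\<nu> 1) \<and>
    (\<forall>i\<in>{0,1}.
      iid_with_density (P i) \<zeta> (f i) \<longrightarrow> scale_function (T i) (\<nu> i) (t i) \<theta> d (W i) \<longrightarrow>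
        invertible (W i (- a + b + d)) \<and>
        (\<integral>\<^sup>+\<omega>. ennreal_of_enat (N \<omega>) \<partial>P i) = ennreal (
          - integral {0..- a} (\<lambda>y. \<nu> i \<bullet> (W i y *v t i))
          + \<nu> i \<bullet> ((W i (- a) ** matrix_inv (W i (- a + b + d))) *v
              (integral {0..- a + b + d} (\<lambda>y. W i y *v t i) + 1))))"
proof -
  note tilt = exponential_tilting[OF PH0 \<theta>, folded t0, folded G0, folded \<Delta>, folded T1, folded \<nu>1]
  have G_pos: "0 < G\<^sub>0" and G_less: "G\<^sub>0 < 1" and PH1: "phase_type_params (T 1) (\<nu> 1)"
    and t1': "t 1 = exit_rates (T 1)" and f1': "f 1 = phase_type_density (T 1) (\<nu> 1)"
    using tilt t1 f1 f0 by (simp_all only:)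
  have d_pos: "0 < d" using G_pos G_less by (simp add: d)
  have "invertible (W i (- a + b + d)) \<and>
        (\<integral>\<^sup>+\<omega>. ennreal_of_enat (N \<omega>) \<partial>P i) = ennreal (
          - integral {0..- a} (\<lambda>y. \<nu> i \<bullet> (W i y *v t i))
          + \<nu> i \<bullet> ((W i (- a) ** matrix_inv (W i (- a + b + d))) *v
              (integral {0..- a + b + d} (\<lambda>y. W i y *v t i) + 1)))"
    if i: "i \<in> {0, 1}" and iid: "iid_with_density (P i) \<zeta> (f i)" and W: "scale_function (T i) (\<nu> i) (t i) \<theta> d (W i)" for i
  proof -
    have PH: "phase_type_params (T i) (\<nu> i)" and t: "t i = exit_rates (T i)" and f: "f i = phase_type_density (T i) (\<nu> i)"
      using i PH0 PH1 t0 t1' f0 f1' by auto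
    have pos: "0 < f 0 x" if "0 < f i x" for x
    proof (cases "i = 0")
      case False
      with i that have "0 < 1 / G\<^sub>0 * exp (- \<theta> * x) * f 0 x" by (simp only: f1 insert_iff empty_iff simp_thms)
      moreover have "0 < 1 / G\<^sub>0 * exp (- \<theta> * x)" using G_pos by simp
      ultimately show ?thesis by (rule zero_less_mult_pos)
    qed (use that in simp)
    have "AE \<omega> in P i. \<forall>k. log_likelihood_ratio (f 0) (f 1) \<zeta> k \<omega> = (\<Sum>j=1..k. \<theta> * \<zeta> j \<omega> - d)"
      unfolding f1 by (rule log_likelihood_ratio_tilted[OF iid _ G_pos d]) (rule pos)
    then have "AE \<omega> in P i. N \<omega> = Inf (enat ` {k. (\<Sum>j=1..k. \<theta> * \<zeta> j \<omega> - d) \<notin> {a<..<b}})"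
    proof eventually_elim
      case (elim \<omega>)
      then show ?case by (simp only: N num_observations_def)
    qed
    then have "(\<integral>\<^sup>+\<omega>. ennreal_of_enat (N \<omega>) \<partial>P i) =
        (\<integral>\<^sup>+\<omega>. ennreal_of_enat (Inf (enat ` {k. (\<Sum>j=1..k. \<theta> * \<zeta> j \<omega> - d) \<notin> {a<..<b}})) \<partial>P i)"
      by (intro nn_integral_cong_AE) (auto elim!: eventually_mono)
    also have "\<dots> = ennreal (
          - integral {0..- a} (\<lambda>y. \<nu> i \<bullet> (W i y *v t i))
          + \<nu> i \<bullet> ((W i (- a) ** matrix_inv (W i (- a + b + d))) *v
              (integral {0..- a + b + d} (\<lambda>y. W i y *v t i) + 1)))"
      unfolding t by (rule expected_exit_time[OF PH W[unfolded t] d_pos \<theta> a b iid[unfolded f]])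
    finally show ?thesis
      using scale_function_invertible[OF PH W[unfolded t] d_pos \<theta>, of "- a + b + d"] a b d_pos by simp
  qed
  with d_pos PH1 t1' f1' show ?thesis by blast
qed

end
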